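(* Let $n,m\ge 1$ be integers and let $0\le\alpha<mn$. Then there is a constant $C=C(m,n,\alpha)>0$ such that for every $m$-tuple $\vec f=(f_1,\dots,f_m)$ of locally integrable functions on $\mathbb{R}^n$ and every $\lambda>0$, $$\Big|\big\{x\in\mathbb{R}^n:\ \mathcal{M}_{\mathcal{R},\alpha}(\vec f)(x)>\lambda^m\big\}\Big|^{m-\frac{\alpha}{n}}\le C\prod_{i=1}^m\left\{\left[1+\left(\frac{\alpha}{mn}\log^+\prod_{j=1}^m\int_{\mathbb{R}^n}\Phi_n^{(m)}\Big(\frac{|f_j(y)|}{\lambda}\Big)dy\right)^{n-1}\right]^m\int_{\mathbb{R}^n}\Phi_n^{(m)}\Big(\frac{|f_i(y)|}{\lambda}\Big)dy\right\}.$$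
   Context: $\mathcal{R}$ is the collection of all rectangles in $\mathbb{R}^n$ with sides parallel to the coordinate axes, and $|E|$ denotes the Lebesgue measure of $E$. The multilinear fractional strong maximal operator is $$\mathcal{M}_{\mathcal{R},\alpha}(\vec f)(x)=\sup_{R\in\mathcal{R},\,R\ni x}\ \prod_{i=1}^m\frac{1}{|R|^{1-\frac{\alpha}{mn}}}\int_R|f_i(y)|\,dy,\qquad x\in\mathbb{R}^n.$$ $\log^+t=\max\{\log t,0\}$ (with $\log^+0=0$), $\Phi_n(t)=t\,[1+(\log^+t)^{n-1}]$ for $t>0$, $\Phi_n(0)=0$, and $\Phi_n^{(m)}$ is the $m$-fold composition of $\Phi_n$ with itself. A power with exponent $n-1=0$ is read as $1$, and $0\cdot\infty=0$. *)

theory Defs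
  imports "HOL-Analysis.Analysis"
begin

definition locally_integrable :: "(real ^ 'n \<Rightarrow> complex) \<Rightarrow> bool"
  where "locally_integrable f \<longleftrightarrow> (\<forall>K. compact K \<longrightarrow> f absolutely_integrable_on K)"

text \<open>
  Rectangles are taken open and nondegenerate. Taking closed or half-open ones instead
  does not change the maximal function below at any point: a rectangle containing \<open>x\<close> lies in
  slightly larger open ones, and both its volume and the integrals over it are limits of theirs.
\<close>

definition rectangles :: "(real ^ 'n) set set"
  where "rectangles = {box a b | a b. \<forall>k. a $ k < b $ k}"

text \<open>The \<open>m\<close>-tuple is given by the values \<open>f i\<close> for \<open>i < m\<close>; the dimension is \<open>CARD('n)\<close>.\<close>

definition frac_strong_maximal ::
  "nat \<Rightarrow> real \<Rightarrow> (nat \<Rightarrow> real ^ 'n \<Rightarrow> complex) \<Rightarrow> real ^ 'n \<Rightarrow> ennreal"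
  where "frac_strong_maximal m \<alpha> f x =
    (SUP R\<in>{R \<in> rectangles. x \<in> R}.
      \<Prod>i<m. (\<integral>\<^sup>+y\<in>R. ennreal (cmod (f i y)) \<partial>lebesgue) /
        ennreal (measure lebesgue R powr (1 - \<alpha> / (real m * real CARD('n)))))"

definition log_plus :: "real \<Rightarrow> real"
  where "log_plus t = (if t \<le> 0 then 0 else max (ln t) 0)"

definition elog_plus :: "ennreal \<Rightarrow> ennreal"
  where "elog_plus t = (if t = \<infinity> then \<infinity> else ennreal (log_plus (enn2real t)))"

text \<open>Only positive exponents are relevant; hence the value at infinity.\<close>

definition epowr :: "ennreal \<Rightarrow> real \<Rightarrow> ennreal"
  where "epowr t p = (if t = \<infinity> then \<infinity> else ennreal (enn2real t powr p))"

text \<open>Relevant for \<open>t \<ge> 0\<close> only.\<close>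

definition Phi :: "nat \<Rightarrow> real \<Rightarrow> real"
  where "Phi n t = t * (1 + log_plus t ^ (n - 1))"

text \<open>The integral over the whole space of the \<open>m\<close>-fold iterate of \<open>Phi\<close> applied to
  \<open>\<bar>g\<bar> / s\<close>; it may be infinite.\<close>

definition Phi_integral :: "nat \<Rightarrow> real \<Rightarrow> (real ^ 'n \<Rightarrow> complex) \<Rightarrow> ennreal"
  where "Phi_integral m s g =
    (\<integral>\<^sup>+y. ennreal ((Phi CARD('n) ^^ m) (cmod (g y) / s)) \<partial>lebesgue)"

text \<open>The level sets are open, so their Lebesgue measure is meaningful.\<close>

lemma open_frac_strong_maximal_level_set:
  "open {x. frac_strong_maximal m \<alpha> f x > c}"
proof -
  have "{x. frac_strong_maximal m \<alpha> f x > c} =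
    \<Union>{R \<in> rectangles. c < (\<Prod>i<m. (\<integral>\<^sup>+y\<in>R. ennreal (cmod (f i y)) \<partial>lebesgue) /
        ennreal (measure lebesgue R powr (1 - \<alpha> / (real m * real CARD('a)))))}"
    unfolding frac_strong_maximal_def less_SUP_iff by blast
  moreover have "open R" if "R \<in> rectangles" for R :: "(real ^ 'a) set"
    using that unfolding rectangles_def by (auto simp: open_box)
  ultimately show ?thesis
    by (auto intro!: open_Union)
qed

end

theory Submission
  imports Defs
begin

text \<open>
  The linear case \<open>m = 1\<close>, \<open>\<alpha> = 0\<close> follows by iterating one-dimensional maximal functions: each
  of them costs one logarithm, and the first one none, because of its weak type estimate.

  For \<open>\<alpha> = 0\<close> and a finite family of rectangles with union \<open>E\<close>, on which the product of the
  averages of the \<open>f\<^sub>i\<close> exceeds 1, take as \<open>\<mu>\<^sub>i\<close> (a multiple of) the Luxemburg norm of \<open>f\<^sub>i\<close> on \<open>E\<close>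
  for the Young function \<open>\<Phi>\<close>. If \<open>\<Prod>\<^sub>i \<mu>\<^sub>i \<le> 1\<close>, then on each rectangle some \<open>f\<^sub>i / \<mu>\<^sub>i\<close> has average above 1, which the
  linear case excludes. So \<open>\<Prod>\<^sub>i \<mu>\<^sub>i > 1\<close>, and the logarithms lost for the \<open>\<mu>\<^sub>i \<le> 1\<close> are regained from
  the iterates of \<open>\<Phi>\<close> for the \<open>\<mu>\<^sub>i > 1\<close>. This uses that all averages are over \<open>E\<close>
  itself; it fails for functions that live on a larger set.

  For \<open>\<alpha> > 0\<close> every rectangle of the family has measure at most \<open>\<bar>E\<bar>\<close>, so the case \<open>\<alpha> = 0\<close> applies to
  \<open>\<bar>E\<bar>\<^sup>\<beta> f\<^sub>i\<close> with \<open>\<beta> = \<alpha> / (m n)\<close>. The resulting power of \<open>log\<^sup>+ \<bar>E\<bar>\<close> is then absorbed.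
\<close>

section \<open>One-dimensional weak type estimate\<close>

text \<open>The number of iterates comes from a balance of logarithms. One application of
  \<open>Phi\<close> pays for the linear estimate on E. The other m - 1 pay for the small norms: if
  P is the product of the norms above 1 and the product of all norms exceeds 1, then 1 / \<mu>_i
  \<le> P for each small \<mu>_i. So a small norm loses no more than a power of log P, and at most m
  - 1 norms are small. The linear estimate can be iterated over the coordinates because the weak
  type inequality is used with its right-hand side truncated to values above half the level. Summed
  over dyadic levels, it reproduces an estimate of the same kind with one more logarithm and half
  the threshold. For \<alpha> > 0 it matters that finite families have unions of finite measure: a
  power of |E| and a logarithm of |E| appear on the right, and the inequality is divided by that
  power. The resulting bound does not depend on the family, so it passes to the level set, a
  countable union of open rectangles.\<close>

lemma interval_family_weak_type:
  fixes g :: "real \<Rightarrow> ennreal" and c :: ennreal and G :: "(real \<times> real) set"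
  assumes g [measurable]: "g \<in> borel_measurable lborel" and "finite G"
    and "\<And>I. I \<in> G \<Longrightarrow> fst I < snd I"
    and "\<And>I. I \<in> G \<Longrightarrow>
      c * ennreal (snd I - fst I) \<le> (\<integral>\<^sup>+y\<in>{fst I<..<snd I}. g y \<partial>lborel)"
  shows "c * emeasure lborel (\<Union>I\<in>G. {fst I<..<snd I}) \<le>
    3 * (\<integral>\<^sup>+y\<in>(\<Union>I\<in>G. {fst I<..<snd I}). g y \<partial>lborel)"
  using assms(2-)
proof (induction G rule: finite_psubset_induct)
  case (psubset G)
  define i where "i I = {fst I<..<snd I}" for I :: "real \<times> real"
  have i_meas [measurable]: "i I \<in> sets borel" for I by (simp add: i_def)
  show ?case
  proof (cases "G = {}")
    case False
    \<comment> \<open>Vitali selection: every interval that meets a longest interval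
      \<open>I\<close> lies in its threefold enlargement \<open>T\<close>, so only the intervals
      disjoint from \<open>I\<close> are left to the induction. Disjointness also lets the integrals
      add up over the union, which keeps the right-hand side local.\<close>
    obtain I where I: "I \<in> G" "\<And>J. J \<in> G \<Longrightarrow> snd J - fst J \<le> snd I - fst I"
    proof -
      have "Max ((\<lambda>J. snd J - fst J) ` G) \<in> (\<lambda>J. snd J - fst J) ` G"
        using False psubset(1) by (intro Max_in) auto
      then obtain I where "I \<in> G" "Max ((\<lambda>J. snd J - fst J) ` G) = snd I - fst I"
        by (elim imageE) blast
      then show ?thesis
        using that[of I] Max_ge[OF finite_imageI[OF psubset(1)], OF imageI, of _ "\<lambda>J. snd J - fst J"]
        by simp
    qed
    define H where "H = {J \<in> G. i J \<inter> i I = {}}"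
    have "i I \<noteq> {}" using psubset.prems(1)[OF I(1)] by (simp add: i_def)
    then have "H \<subset> G" using I(1) by (auto simp: H_def)
    have finH: "finite H" using psubset(1) \<open>H \<subset> G\<close> finite_subset by blast
    have IH: "c * emeasure lborel (\<Union>J\<in>H. i J) \<le> 3 * (\<integral>\<^sup>+y\<in>(\<Union>J\<in>H. i J). g y \<partial>lborel)"
      unfolding i_def using \<open>H \<subset> G\<close> psubset.prems by (intro psubset.IH) auto
    define T where "T = {fst I - (snd I - fst I)<..<snd I + (snd I - fst I)}"
    have pos: "fst I < snd I" by (rule psubset.prems(1)[OF I(1)])
    have "i J \<subseteq> T \<union> (\<Union>J\<in>H. i J)" if J: "J \<in> G" for J
    proof (cases "J \<in> H")
      case False
      then obtain z where "z \<in> i J" "z \<in> i I" using J by (auto simp: H_def)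
      then show ?thesis using I(2)[OF J] by (auto simp: i_def T_def)
    qed auto
    then have sub: "(\<Union>J\<in>G. i J) \<subseteq> T \<union> (\<Union>J\<in>H. i J)" by blast
    have mH [measurable]: "(\<Union>J\<in>H. i J) \<in> sets borel" using finH by (intro sets.finite_UN) auto
    have mT [measurable]: "T \<in> sets borel" by (simp add: T_def)
    have disj: "i I \<inter> (\<Union>J\<in>H. i J) = {}" by (auto simp: H_def)
    have "emeasure lborel T = 3 * ennreal (snd I - fst I)"
    proof -
      have "emeasure lborel T = ennreal (3 * (snd I - fst I))"
        using pos by (simp add: T_def algebra_simps)
      also have "\<dots> = 3 * ennreal (snd I - fst I)"
        using pos by (subst ennreal_mult) auto
      finally show ?thesis .
    qed
    have "c * emeasure lborel (\<Union>J\<in>G. i J) \<le> c * emeasure lborel (T \<union> (\<Union>J\<in>H. i J))"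
      using sub by (intro mult_left_mono emeasure_mono) auto
    also have "\<dots> \<le> c * (emeasure lborel T + emeasure lborel (\<Union>J\<in>H. i J))"
      by (intro mult_left_mono emeasure_subadditive) auto
    also have "\<dots> = 3 * (c * ennreal (snd I - fst I)) + c * emeasure lborel (\<Union>J\<in>H. i J)"
      using \<open>emeasure lborel T = _\<close> by (simp add: distrib_left mult.left_commute)
    also have "\<dots> \<le> 3 * (\<integral>\<^sup>+y\<in>i I. g y \<partial>lborel) + 3 * (\<integral>\<^sup>+y\<in>(\<Union>J\<in>H. i J). g y \<partial>lborel)"
      using psubset.prems(2)[OF I(1)] IH by (intro add_mono mult_left_mono) (auto simp: i_def)
    also have "\<dots> = 3 * (\<integral>\<^sup>+y\<in>i I \<union> (\<Union>J\<in>H. i J). g y \<partial>lborel)"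
      using disj by (subst nn_integral_disjoint_pair) (auto simp: distrib_left)
    also have "\<dots> \<le> 3 * (\<integral>\<^sup>+y\<in>(\<Union>J\<in>G. i J). g y \<partial>lborel)"
      using I(1) by (intro mult_left_mono nn_set_integral_set_mono) (auto simp: H_def)
    finally show ?thesis by (simp add: i_def)
  qed simp
qed

text \<open>The part of \<open>g\<close> not exceeding \<open>c / 2\<close> has averages at most
  \<open>c / 2\<close>, so the remaining part still has averages at least \<open>c / 2\<close> on
  every selected interval. Without this truncation the later sum over dyadic levels would diverge.
  The constant is 2 * 3.\<close>

lemma interval_max_weak_type:
  fixes g :: "real \<Rightarrow> ennreal" and c :: ennreal and G :: "(real \<times> real) set"
  assumes g [measurable]: "g \<in> borel_measurable lborel" and G: "finite G"
    and pos: "\<And>I. I \<in> G \<Longrightarrow> fst I < snd I" and c: "c \<noteq> \<infinity>"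
  shows "c * emeasure lborel {y. c < (SUP I\<in>G. indicator {fst I<..<snd I} y *
      ((\<integral>\<^sup>+z\<in>{fst I<..<snd I}. g z \<partial>lborel) / ennreal (snd I - fst I)))} \<le>
    6 * (\<integral>\<^sup>+y. g y * indicator {c / 2<..} (g y) \<partial>lborel)"
proof -
  define i where "i I = {fst I<..<snd I}" for I :: "real \<times> real"
  define G' where "G' = {I \<in> G. c < (\<integral>\<^sup>+z\<in>i I. g z \<partial>lborel) / ennreal (snd I - fst I)}"
  define g' where "g' y = g y * indicator {c / 2<..} (g y)" for y
  have [measurable]: "g' \<in> borel_measurable lborel" unfolding g'_def by measurable
  have c2: "c / 2 + c / 2 = c" 
    by (metis add_divide_distrib_ennreal mult_2 mult.commute mult_divide_eq_ennreal
        ennreal_numeral ennreal_neq_top zero_neq_numeral)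
  have set_eq: "{y. c < (SUP I\<in>G. indicator (i I) y *
      ((\<integral>\<^sup>+z\<in>i I. g z \<partial>lborel) / ennreal (snd I - fst I)))} = (\<Union>I\<in>G'. i I)"
    unfolding less_SUP_iff G'_def by (auto simp: indicator_def split: if_splits)
  have half: "(c / 2) * ennreal (snd I - fst I) \<le> (\<integral>\<^sup>+y\<in>i I. g' y \<partial>lborel)" if "I \<in> G'" for I
  proof -
    have I: "fst I < snd I" using that pos by (auto simp: G'_def)
    have "c * ennreal (snd I - fst I) \<le>
        (\<integral>\<^sup>+z\<in>i I. g z \<partial>lborel) / ennreal (snd I - fst I) * ennreal (snd I - fst I)"
      using that by (intro mult_right_mono) (auto simp: G'_def less_imp_le)
    also have "\<dots> = (\<integral>\<^sup>+z\<in>i I. g z \<partial>lborel)"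
      using I by (subst ennreal_divide_times) (simp add: ennreal_divide_self)
    also have "\<dots> \<le> (\<integral>\<^sup>+z. (g' z * indicator (i I) z + c / 2 * indicator (i I) z) \<partial>lborel)"
      by (intro nn_integral_mono) (auto simp: g'_def indicator_def not_less)
    also have "\<dots> = (\<integral>\<^sup>+z\<in>i I. g' z \<partial>lborel) + c / 2 * ennreal (snd I - fst I)"
      using I by (subst nn_integral_add) (auto simp: i_def nn_integral_cmult)
    finally have "c / 2 * ennreal (snd I - fst I) + c / 2 * ennreal (snd I - fst I) \<le>
        (\<integral>\<^sup>+z\<in>i I. g' z \<partial>lborel) + c / 2 * ennreal (snd I - fst I)"
      by (simp flip: distrib_right add: c2)
    moreover have "c / 2 * ennreal (snd I - fst I) \<noteq> \<infinity>"
      using c by (simp add: ennreal_mult_eq_top_iff ennreal_divide_eq_top_iff)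
    ultimately show ?thesis by (simp add: add.commute ennreal_add_left_cancel_le)
  qed
  have "(c / 2) * emeasure lborel (\<Union>I\<in>G'. i I) \<le> 3 * (\<integral>\<^sup>+y\<in>(\<Union>I\<in>G'. i I). g' y \<partial>lborel)"
    unfolding i_def
    using half pos G by (intro interval_family_weak_type) (auto simp: G'_def i_def)
  also have "\<dots> \<le> 3 * (\<integral>\<^sup>+y. g' y \<partial>lborel)"
    by (intro mult_left_mono nn_integral_mono) (auto simp: indicator_def)
  finally have "2 * ((c / 2) * emeasure lborel (\<Union>I\<in>G'. i I)) \<le> 2 * (3 * (\<integral>\<^sup>+y. g' y \<partial>lborel))"
    by (rule mult_left_mono) simp
  moreover have "2 * ((c / 2) * emeasure lborel (\<Union>I\<in>G'. i I)) = c * emeasure lborel (\<Union>I\<in>G'. i I)"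
    by (metis c2 mult.assoc mult_2)
  ultimately show ?thesis
    using set_eq unfolding i_def g'_def by (simp add: mult.assoc[symmetric])
qed

section \<open>Maximal operators in a single coordinate\<close>

definition coord_max :: "(real \<times> real) set \<Rightarrow> 'i \<Rightarrow> (('i \<Rightarrow> real) \<Rightarrow> ennreal) \<Rightarrow>
    ('i \<Rightarrow> real) \<Rightarrow> ennreal"
  where "coord_max G k f x = (SUP I\<in>G. indicator {fst I<..<snd I} (x k) *
    ((\<integral>\<^sup>+y\<in>{fst I<..<snd I}. f (x(k := y)) \<partial>lborel) / ennreal (snd I - fst I)))"

text \<open>Points are functions on the index type rather than vectors, so that freezing all
  coordinates but one is a function update and Tonelli's theorem for product measures applies to a
  single coordinate.\<close>

abbreviation lborel_fun :: "('i \<Rightarrow> real) measure"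
  where "lborel_fun \<equiv> Pi\<^sub>M UNIV (\<lambda>_. lborel)"

lemma measurable_fun_upd_pair [measurable]:
  "(\<lambda>p. (fst p)(k := snd p)) \<in> lborel_fun \<Otimes>\<^sub>M lborel \<rightarrow>\<^sub>M lborel_fun"
  by (rule measurable_PiM_single') (auto simp: space_PiM)

lemma measurable_fun_upd_slice [measurable]:
  "(\<lambda>y. x(k := y)) \<in> lborel \<rightarrow>\<^sub>M lborel_fun"
  by (rule measurable_PiM_single') (auto simp: space_PiM)

lemma measurable_coord_max [measurable]:
  assumes [measurable]: "f \<in> borel_measurable lborel_fun" and G: "finite G"
  shows "coord_max G k f \<in> borel_measurable lborel_fun"
proof -
  have "(\<lambda>p. f ((fst p)(k := snd p))) \<in> borel_measurable (lborel_fun \<Otimes>\<^sub>M lborel)"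
    by measurable
  note [measurable] = this
  have "(\<lambda>x. \<integral>\<^sup>+y\<in>{fst I<..<snd I}. f (x(k := y)) \<partial>lborel) \<in> borel_measurable lborel_fun" for I
    by (rule lborel.borel_measurable_nn_integral) measurable
  note [measurable] = this
  have [measurable]: "(\<lambda>x. x k) \<in> borel_measurable lborel_fun" by measurable
  show ?thesis
    unfolding coord_max_def using G
    by (intro borel_measurable_SUP countable_finite) measurable
qed

text \<open>On every line parallel to the \<open>k\<close>-th axis the one-dimensional estimate
  holds with the same constant, and it survives integration over the other coordinates.\<close>

lemma coord_max_weak_type:
  fixes f :: "('i::finite \<Rightarrow> real) \<Rightarrow> ennreal"
  assumes f [measurable]: "f \<in> borel_measurable lborel_fun" and G: "finite G"
    and pos: "\<And>I. I \<in> G \<Longrightarrow> fst I < snd I" and c: "c \<noteq> \<infinity>"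
  shows "c * emeasure lborel_fun {x. c < coord_max G k f x} \<le>
    6 * (\<integral>\<^sup>+x. f x * indicator {c / 2<..} (f x) \<partial>lborel_fun)"
proof -
  interpret product_sigma_finite "\<lambda>_::'i. lborel :: real measure" ..
  note [measurable] = measurable_coord_max[OF f G]
  have UNIV: "insert k (UNIV - {k}) = UNIV" by auto
  have split: "(\<integral>\<^sup>+x. h x \<partial>lborel_fun) =
      (\<integral>\<^sup>+x. \<integral>\<^sup>+y. h (x(k := y)) \<partial>lborel \<partial>Pi\<^sub>M (UNIV - {k}) (\<lambda>_. lborel))"
    if "h \<in> borel_measurable lborel_fun" for h :: "('i \<Rightarrow> real) \<Rightarrow> ennreal"
    using product_nn_integral_insert[of "UNIV - {k}" k h] that by (simp add: UNIV)
  have [measurable]: "{x. c < coord_max G k f x} \<in> sets lborel_fun"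
  proof -
    have "{x \<in> space lborel_fun. c < coord_max G k f x} \<in> sets lborel_fun" by measurable
    then show ?thesis by (simp add: space_PiM)
  qed
  have slice: "(\<integral>\<^sup>+y. c * indicator {x. c < coord_max G k f x} (x(k := y)) \<partial>lborel) \<le>
      (\<integral>\<^sup>+y. 6 * (f (x(k := y)) * indicator {c / 2<..} (f (x(k := y)))) \<partial>lborel)" for x
  proof -
    define g where "g y = f (x(k := y))" for y
    have [measurable]: "g \<in> borel_measurable lborel" unfolding g_def by measurable
    have "(\<lambda>y. coord_max G k f (x(k := y))) = (\<lambda>y. SUP I\<in>G. indicator {fst I<..<snd I} y *
      ((\<integral>\<^sup>+z\<in>{fst I<..<snd I}. g z \<partial>lborel) / ennreal (snd I - fst I)))"
      by (simp add: coord_max_def g_def)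
    then have eq: "{y. c < coord_max G k f (x(k := y))} = {y. c < (SUP I\<in>G. indicator {fst I<..<snd I} y *
      ((\<integral>\<^sup>+z\<in>{fst I<..<snd I}. g z \<partial>lborel) / ennreal (snd I - fst I)))}"
      by metis
    have [measurable]: "(\<lambda>y. coord_max G k f (x(k := y))) \<in> borel_measurable lborel"
      by measurable
    have "{y \<in> space lborel. c < coord_max G k f (x(k := y))} \<in> sets lborel"
      by measurable
    then have [measurable]: "{y. c < coord_max G k f (x(k := y))} \<in> sets borel" by simp
    have "(\<integral>\<^sup>+y. c * indicator {x. c < coord_max G k f x} (x(k := y)) \<partial>lborel) =
        (\<integral>\<^sup>+y. c * indicator {y. c < coord_max G k f (x(k := y))} y \<partial>lborel)"
      by (intro nn_integral_cong) (auto simp: indicator_def)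
    also have "\<dots> = c * emeasure lborel {y. c < coord_max G k f (x(k := y))}"
      by (intro nn_integral_cmult_indicator) measurable
    also have "\<dots> \<le> 6 * (\<integral>\<^sup>+y. g y * indicator {c / 2<..} (g y) \<partial>lborel)"
      unfolding eq by (rule interval_max_weak_type) (use assms in auto)
    also have "\<dots> = (\<integral>\<^sup>+y. 6 * (g y * indicator {c / 2<..} (g y)) \<partial>lborel)"
      by (rule nn_integral_cmult[symmetric]) measurable
    finally show ?thesis by (simp add: g_def)
  qed
  have "c * emeasure lborel_fun {x. c < coord_max G k f x} =
      (\<integral>\<^sup>+x. c * indicator {x. c < coord_max G k f x} x \<partial>lborel_fun)"
    by (rule nn_integral_cmult_indicator[symmetric]) measurable
  also have "\<dots> = (\<integral>\<^sup>+x. \<integral>\<^sup>+y. c * indicator {x. c < coord_max G k f x} (x(k := y)) \<partial>lborel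
      \<partial>Pi\<^sub>M (UNIV - {k}) (\<lambda>_. lborel))"
    by (rule split) measurable
  also have "\<dots> \<le> (\<integral>\<^sup>+x. \<integral>\<^sup>+y. 6 * (f (x(k := y)) * indicator {c / 2<..} (f (x(k := y))))
      \<partial>lborel \<partial>Pi\<^sub>M (UNIV - {k}) (\<lambda>_. lborel))"
    by (intro nn_integral_mono slice)
  also have "\<dots> = (\<integral>\<^sup>+x. 6 * (f x * indicator {c / 2<..} (f x)) \<partial>lborel_fun)"
    by (rule split[symmetric]) measurable
  also have "\<dots> = 6 * (\<integral>\<^sup>+x. f x * indicator {c / 2<..} (f x) \<partial>lborel_fun)"
    by (rule nn_integral_cmult) measurable
  finally show ?thesis .
qed

section \<open>Logarithmic weights and iterated maximal functions\<close>

text \<open>A discrete version of \<open>t (1 + log (t / s))\<^sup>j\<close> for \<open>t > s\<close>, zero for \<open>t \<le> s\<close>. Being a sum over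
  level sets, its integral depends only on the distribution function, also where \<open>t = \<infinity>\<close>.\<close>

definition dyadic_log :: "nat \<Rightarrow> ennreal \<Rightarrow> ennreal \<Rightarrow> ennreal"
  where "dyadic_log j s t = (\<Sum>k. s * 2 ^ k * of_nat ((k + 1) ^ j) * indicator {s * 2 ^ k<..} t)"

lemma measurable_dyadic_log [measurable]: "dyadic_log j s \<in> borel_measurable borel"
  unfolding dyadic_log_def by measurable

lemma dyadic_indicator_eq_0:
  fixes s t :: ennreal
  assumes "t \<le> s"
  shows "indicator {s * 2 ^ k<..} t = (0 :: ennreal)"
proof -
  have "s * 1 \<le> s * 2 ^ k"
    by (intro mult_left_mono) (auto simp: one_le_power)
  then have "t \<le> s * 2 ^ k"
    using assms by simp
  then show ?thesis
    by (simp add: not_less)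
qed

lemma dyadic_log_eq_0: "t \<le> s \<Longrightarrow> dyadic_log j s t = 0"
  by (simp add: dyadic_log_def dyadic_indicator_eq_0)

lemma dyadic_log_top:
  assumes "0 < s" "s < \<infinity>"
  shows "dyadic_log j s \<infinity> = \<infinity>"
proof -
  have "s * 1 * 1 \<le> s * 2 ^ k * of_nat ((k + 1) ^ j) * indicator {s * 2 ^ k<..} \<infinity>" for k :: nat
  proof -
    have "s * 2 ^ k \<noteq> \<infinity>" using assms
      by (simp add: ennreal_mult_eq_top_iff power_eq_top_ennreal)
    then have "s * 2 ^ k < \<infinity>" by (simp add: less_top)
    moreover have "(1::ennreal) \<le> of_nat ((k + 1) ^ j)"
      by (metis One_nat_def add.commute of_nat_1 of_nat_mono one_le_power le_add1 plus_1_eq_Suc)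
    moreover from this have "s * 1 * 1 \<le> s * 2 ^ k * of_nat ((k + 1) ^ j)"
      by (intro mult_mono one_le_power) auto
    ultimately show ?thesis
      by (simp add: indicator_def)
  qed
  then have "(\<integral>\<^sup>+k. s \<partial>count_space (UNIV :: nat set)) \<le> dyadic_log j s \<infinity>"
    unfolding dyadic_log_def nn_integral_count_space_nat[symmetric]
    by (intro nn_integral_mono) auto
  then show ?thesis using assms by (auto simp: top_unique ennreal_mult_top split: if_splits)
qed

lemma dyadic_level_obtain:
  fixes s t :: ennreal
  assumes "0 < s" "s < t" "t < \<infinity>"
  obtains K :: nat where "s * 2 ^ K < t" "t \<le> s * 2 ^ Suc K"
    "\<And>k. indicator {s * 2 ^ k<..} t = (if k \<le> K then 1 else (0 :: ennreal))"
proof -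
  obtain s' where s': "s = ennreal s'" "0 < s'" using assms
    by (cases s) (auto simp: less_top[symmetric])
  obtain t' where t': "t = ennreal t'" "0 \<le> t'" using assms
    by (cases t) (auto simp: less_top[symmetric])
  have pw: "s * 2 ^ k = ennreal (s' * 2 ^ k)" for k :: nat
    using s' by (simp add: ennreal_mult ennreal_power[symmetric])
  obtain N :: nat where "t' / s' < 2 ^ N" using real_arch_pow[of 2 "t' / s'"] by auto
  then have "t' \<le> s' * 2 ^ N" using s' by (simp add: field_simps)
  then have ex: "\<exists>k. t' \<le> s' * 2 ^ k" by blast
  define M where "M = (LEAST k. t' \<le> s' * 2 ^ k)"
  have M: "t' \<le> s' * 2 ^ M" unfolding M_def by (rule LeastI_ex[OF ex])
  have lt: "s' * 2 ^ k < t'" if "k < M" for k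
    using not_less_Least[of k "\<lambda>k. t' \<le> s' * 2 ^ k"] that by (simp add: M_def)
  have ge: "t' \<le> s' * 2 ^ k" if "M \<le> k" for k
  proof -
    have "s' * 2 ^ M \<le> s' * 2 ^ k" using that s' by (intro mult_left_mono power_increasing) auto
    then show ?thesis using M by linarith
  qed
  have "M \<noteq> 0" using M assms s' t' by (intro notI) (simp add: ennreal_less_iff)
  then obtain K where K: "M = Suc K" using not0_implies_Suc by blast
  show ?thesis
  proof (rule that[of K])
    show "s * 2 ^ K < t" using lt[of K] K s'(2) unfolding pw t' by (simp add: ennreal_less_iff)
    show "t \<le> s * 2 ^ Suc K" using M K unfolding pw t' by (intro ennreal_leI) auto
    show "indicator {s * 2 ^ k<..} t = (if k \<le> K then 1 else (0 :: ennreal))" for k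
    proof -
      have "s * 2 ^ k < t \<longleftrightarrow> k \<le> K"
        using lt[of k] ge[of k] K s'(2) not_less_eq_eq[of k K] unfolding pw t' by (auto simp: ennreal_less_iff)
      then show ?thesis by (simp add: indicator_def)
    qed
  qed
qed

lemma dyadic_log_ge_term:
  "s * 2 ^ k * of_nat ((k + 1) ^ j) * indicator {s * 2 ^ k<..} t \<le> dyadic_log j s t"
  unfolding dyadic_log_def
  using sum_le_suminf[OF summableI, of "{k}" "\<lambda>k. s * 2 ^ k * of_nat ((k + 1) ^ j) * indicator {s * 2 ^ k<..} t"]
  by (simp del: of_nat_power sum_mult_indicator)

text \<open>The highest active level lies within a factor 2 of \<open>t\<close>, so its term alone
  suffices. This turns the weak type bound for the outermost operator into a dyadic integral without
  logarithm.\<close>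

lemma indicator_le_dyadic_log:
  assumes s: "0 < s" "s < \<infinity>"
  shows "t * indicator {s<..} t \<le> 2 * dyadic_log 0 s t"
proof (cases "s < t")
  case True
  show ?thesis
  proof (cases "t = \<infinity>")
    case False
    then obtain K where K: "s * 2 ^ K < t" "t \<le> s * 2 ^ Suc K"
      using dyadic_level_obtain[of s t] s True by (metis less_top infinity_ennreal_def)
    have "t \<le> 2 * (s * 2 ^ K)" using K(2) by (simp add: mult_ac)
    also have "\<dots> \<le> 2 * dyadic_log 0 s t"
      using dyadic_log_ge_term[of s K 0 t] K(1) by (intro mult_left_mono) auto
    finally show ?thesis using True by simp
  qed (use dyadic_log_top[of s 0] s in \<open>auto simp: ennreal_mult_top\<close>)
qed simp

text \<open>If \<open>s * 2 ^ K < t\<close> and \<open>t \<le> s * 2 ^ Suc K\<close>, exactly K + 1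
  terms are active, each at most \<open>(K + 1) ^ j\<close>. Their number is the one power of the
  logarithm that a further coordinate costs.\<close>

lemma sum_le_dyadic_log:
  assumes s: "0 < s" "s < \<infinity>"
  shows "t * (\<Sum>k. of_nat ((k + 1) ^ j) * indicator {s * 2 ^ k<..} t) \<le> 2 * dyadic_log (Suc j) s t"
proof -
  consider "t \<le> s" | "t = \<infinity>" | "s < t" "t < \<infinity>"
    using less_top not_less by (metis infinity_ennreal_def)
  then show ?thesis
  proof cases
    case 1
    then show ?thesis by (simp add: dyadic_indicator_eq_0)
  next
    case 2
    then show ?thesis using dyadic_log_top[of s "Suc j"] s by (auto simp: ennreal_mult_top)
  next
    case 3
    obtain K where K: "s * 2 ^ K < t" "t \<le> s * 2 ^ Suc K"
      "\<And>k. indicator {s * 2 ^ k<..} t = (if k \<le> K then 1 else (0 :: ennreal))"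
      using dyadic_level_obtain[OF s(1) 3] by metis
    have "(\<Sum>k. of_nat ((k + 1) ^ j) * indicator {s * 2 ^ k<..} t) =
        (\<Sum>k\<le>K. of_nat ((k + 1) ^ j) * indicator {s * 2 ^ k<..} t :: ennreal)"
      by (rule suminf_finite) (auto simp: K(3))
    also have "\<dots> \<le> (\<Sum>k\<le>K. of_nat ((K + 1) ^ j))"
      by (intro sum_mono) (auto simp: K(3) simp del: of_nat_power intro!: of_nat_mono power_mono)
    also have "\<dots> = of_nat ((K + 1) ^ Suc j)" by (simp add: algebra_simps)
    finally have "t * (\<Sum>k. of_nat ((k + 1) ^ j) * indicator {s * 2 ^ k<..} t) \<le>
        (s * 2 ^ Suc K) * of_nat ((K + 1) ^ Suc j)"
      using K(2) by (intro mult_mono) auto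
    also have "\<dots> = 2 * (s * 2 ^ K * of_nat ((K + 1) ^ Suc j))" by (simp add: mult_ac)
    also have "\<dots> \<le> 2 * dyadic_log (Suc j) s t"
      using dyadic_log_ge_term[of s K "Suc j" t] K(1)
      by (intro mult_left_mono) (auto simp del: of_nat_power power_Suc)
    finally show ?thesis .
  qed
qed

text \<open>The weak type estimate is applied at each level \<open>s * 2 ^ i\<close>; its truncation
  at half that level is the reason for the threshold \<open>s / 2\<close> on the right. After
  exchanging sum and integral, \<open>sum_le_dyadic_log\<close> collects the levels, and 12 = 6 *
  2.\<close>

lemma nn_integral_dyadic_log_coord_max:
  fixes f :: "('i::finite \<Rightarrow> real) \<Rightarrow> ennreal"
  assumes f [measurable]: "f \<in> borel_measurable lborel_fun" and G: "finite G"
    and pos: "\<And>I. I \<in> G \<Longrightarrow> fst I < snd I" and s: "0 < s" "s < \<infinity>"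
  shows "(\<integral>\<^sup>+x. dyadic_log j s (coord_max G k f x) \<partial>lborel_fun) \<le>
    12 * (\<integral>\<^sup>+x. dyadic_log (Suc j) (s / 2) (f x) \<partial>lborel_fun)"
proof -
  note [measurable] = measurable_coord_max[OF f G]
  define a :: "nat \<Rightarrow> ennreal" where "a i = of_nat ((i + 1) ^ j)" for i
  have s2: "0 < s / 2" "s / 2 < \<infinity>"
    using s by (auto simp: ennreal_zero_less_divide less_top[symmetric] ennreal_divide_eq_top_iff)
  have half: "s * 2 ^ i / 2 = s / 2 * 2 ^ i" for i :: nat
    by (simp add: ennreal_times_divide[symmetric] divide_ennreal_def mult_ac)
  have fin: "s * 2 ^ i \<noteq> \<infinity>" for i :: nat
    using s by (simp add: ennreal_mult_eq_top_iff power_eq_top_ennreal)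
  have meas [measurable]: "{x. c < coord_max G k f x} \<in> sets lborel_fun" for c
  proof -
    have "{x \<in> space lborel_fun. c < coord_max G k f x} \<in> sets lborel_fun" by measurable
    then show ?thesis by (simp add: space_PiM)
  qed
  have level: "(\<integral>\<^sup>+x. s * 2 ^ i * a i * indicator {s * 2 ^ i<..} (coord_max G k f x) \<partial>lborel_fun) \<le>
      (\<integral>\<^sup>+x. 6 * (f x * (a i * indicator {s / 2 * 2 ^ i<..} (f x))) \<partial>lborel_fun)" for i
  proof -
    have "(\<integral>\<^sup>+x. s * 2 ^ i * a i * indicator {s * 2 ^ i<..} (coord_max G k f x) \<partial>lborel_fun) =
        (\<integral>\<^sup>+x. s * 2 ^ i * a i * indicator {x. s * 2 ^ i < coord_max G k f x} x \<partial>lborel_fun)"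
      by (intro nn_integral_cong) (auto simp: indicator_def)
    also have "\<dots> = a i * (s * 2 ^ i * emeasure lborel_fun {x. s * 2 ^ i < coord_max G k f x})"
      by (subst nn_integral_cmult_indicator) (auto simp: mult_ac)
    also have "\<dots> \<le> a i * (6 * (\<integral>\<^sup>+x. f x * indicator {s * 2 ^ i / 2<..} (f x) \<partial>lborel_fun))"
      by (intro mult_left_mono coord_max_weak_type assms fin) auto
    also have "\<dots> = (6 * a i) * (\<integral>\<^sup>+x. f x * indicator {s / 2 * 2 ^ i<..} (f x) \<partial>lborel_fun)"
      by (simp only: half mult_ac)
    also have "\<dots> = (\<integral>\<^sup>+x. (6 * a i) * (f x * indicator {s / 2 * 2 ^ i<..} (f x)) \<partial>lborel_fun)"
      by (rule nn_integral_cmult[symmetric]) measurable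
    finally show ?thesis by (simp add: mult_ac)
  qed
  have "(\<integral>\<^sup>+x. dyadic_log j s (coord_max G k f x) \<partial>lborel_fun) =
      (\<Sum>i. \<integral>\<^sup>+x. s * 2 ^ i * a i * indicator {s * 2 ^ i<..} (coord_max G k f x) \<partial>lborel_fun)"
    unfolding dyadic_log_def a_def by (rule nn_integral_suminf) measurable
  also have "\<dots> \<le> (\<Sum>i. \<integral>\<^sup>+x. 6 * (f x * (a i * indicator {s / 2 * 2 ^ i<..} (f x))) \<partial>lborel_fun)"
    by (intro suminf_le level) auto
  also have "\<dots> = (\<integral>\<^sup>+x. (\<Sum>i. 6 * (f x * (a i * indicator {s / 2 * 2 ^ i<..} (f x)))) \<partial>lborel_fun)"
    by (rule nn_integral_suminf[symmetric]) measurable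
  also have "\<dots> = (\<integral>\<^sup>+x. 6 * (f x * (\<Sum>i. a i * indicator {s / 2 * 2 ^ i<..} (f x))) \<partial>lborel_fun)"
    by simp
  also have "\<dots> \<le> (\<integral>\<^sup>+x. 6 * (2 * dyadic_log (Suc j) (s / 2) (f x)) \<partial>lborel_fun)"
    unfolding a_def by (intro nn_integral_mono mult_left_mono sum_le_dyadic_log s2) auto
  also have "\<dots> = (\<integral>\<^sup>+x. 12 * dyadic_log (Suc j) (s / 2) (f x) \<partial>lborel_fun)"
    by (simp add: mult.assoc[symmetric])
  also have "\<dots> = 12 * (\<integral>\<^sup>+x. dyadic_log (Suc j) (s / 2) (f x) \<partial>lborel_fun)"
    by (rule nn_integral_cmult) measurable
  finally show ?thesis .
qed

section \<open>Composition over the coordinates and families of boxes\<close>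

definition strong_max :: "('i \<Rightarrow> (real \<times> real) set) \<Rightarrow> 'i list \<Rightarrow> (('i \<Rightarrow> real) \<Rightarrow> ennreal) \<Rightarrow>
    ('i \<Rightarrow> real) \<Rightarrow> ennreal"
  where "strong_max G ks f = foldr (\<lambda>k. coord_max (G k) k) ks f"

lemma measurable_strong_max [measurable]:
  assumes "f \<in> borel_measurable lborel_fun" and "\<And>k. finite (G k)"
  shows "strong_max G ks f \<in> borel_measurable lborel_fun"
  unfolding strong_max_def by (induction ks) (auto simp: assms)

lemma nn_integral_dyadic_log_strong_max:
  fixes f :: "('i::finite \<Rightarrow> real) \<Rightarrow> ennreal" and s :: real
  assumes f: "f \<in> borel_measurable lborel_fun" and G: "\<And>k. finite (G k)"
    and pos: "\<And>k I. I \<in> G k \<Longrightarrow> fst I < snd I" and s: "0 < s"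
  shows "(\<integral>\<^sup>+x. dyadic_log j (ennreal s) (strong_max G ks f x) \<partial>lborel_fun) \<le>
    12 ^ length ks * (\<integral>\<^sup>+x. dyadic_log (j + length ks) (ennreal (s / 2 ^ length ks)) (f x) \<partial>lborel_fun)"
  using s
\<comment> \<open>Weight and threshold have to vary: peeling off the outermost operator raises
  \<open>j\<close> by one and halves \<open>s\<close>.\<close>
proof (induction ks arbitrary: j s)
  case Nil
  then show ?case by (simp add: strong_max_def)
next
  case (Cons k ks)
  have half: "ennreal s / 2 = ennreal (s / 2)"
    using Cons.prems by (simp add: ennreal_divide_numeral)
  have "(\<integral>\<^sup>+x. dyadic_log j (ennreal s) (strong_max G (k # ks) f x) \<partial>lborel_fun) \<le>
      12 * (\<integral>\<^sup>+x. dyadic_log (Suc j) (ennreal (s / 2)) (strong_max G ks f x) \<partial>lborel_fun)"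
    using nn_integral_dyadic_log_coord_max[OF measurable_strong_max[OF f G] G pos, where s = "ennreal s"]
      Cons.prems by (simp add: strong_max_def half)
  also have "\<dots> \<le> 12 * (12 ^ length ks *
      (\<integral>\<^sup>+x. dyadic_log (Suc j + length ks) (ennreal (s / 2 / 2 ^ length ks)) (f x) \<partial>lborel_fun))"
    using Cons.prems by (intro mult_left_mono Cons.IH) auto
  finally show ?case by (simp add: mult.assoc)
qed

text \<open>The head of \<open>ks\<close> is the outermost operator. The weak type estimate for it
  leaves the weight exponent 0, and each operator below it adds 1, hence
  \<open>length ks - 1\<close>.\<close>

lemma strong_max_weak_type:
  fixes f :: "('i::finite \<Rightarrow> real) \<Rightarrow> ennreal"
  assumes f: "f \<in> borel_measurable lborel_fun" and G: "\<And>k. finite (G k)"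
    and pos: "\<And>k I. I \<in> G k \<Longrightarrow> fst I < snd I" and ks: "ks \<noteq> []"
  shows "emeasure lborel_fun {x. 1 < strong_max G ks f x} \<le>
    12 ^ length ks *
      (\<integral>\<^sup>+x. dyadic_log (length ks - 1) (ennreal (1 / 2 ^ length ks)) (f x) \<partial>lborel_fun)"
proof -
  obtain k ks' where ks': "ks = k # ks'" using ks by (cases ks) auto
  define g where "g = strong_max G ks' f"
  have g [measurable]: "g \<in> borel_measurable lborel_fun"
    unfolding g_def by (rule measurable_strong_max[OF f G])
  have half: "(1::ennreal) / 2 = ennreal (1 / 2)" by (simp add: ennreal_divide_numeral flip: ennreal_1)
  have half_bounds: "0 < ennreal (1 / 2)" "ennreal (1 / 2) < \<infinity>"
    by (simp_all only: ennreal_less_zero_iff infinity_ennreal_def ennreal_less_top)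
  have "emeasure lborel_fun {x. 1 < strong_max G ks f x} =
      1 * emeasure lborel_fun {x. 1 < coord_max (G k) k g x}"
    by (simp add: ks' g_def strong_max_def)
  also have "\<dots> \<le> 6 * (\<integral>\<^sup>+x. g x * indicator {1 / 2<..} (g x) \<partial>lborel_fun)"
    by (rule coord_max_weak_type[OF g G pos]) auto
  also have "\<dots> \<le> 6 * (\<integral>\<^sup>+x. 2 * dyadic_log 0 (ennreal (1 / 2)) (g x) \<partial>lborel_fun)"
    unfolding half
    by (intro mult_left_mono nn_integral_mono indicator_le_dyadic_log half_bounds) simp
  also have "\<dots> = 12 * (\<integral>\<^sup>+x. dyadic_log 0 (ennreal (1 / 2)) (g x) \<partial>lborel_fun)"
    by (subst nn_integral_cmult) (auto simp: mult.assoc[symmetric])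
  also have "\<dots> \<le> 12 * (12 ^ length ks' *
      (\<integral>\<^sup>+x. dyadic_log (0 + length ks') (ennreal (1 / 2 / 2 ^ length ks')) (f x) \<partial>lborel_fun))"
    unfolding g_def
    by (intro mult_left_mono nn_integral_dyadic_log_strong_max assms) auto
  finally show ?thesis by (simp add: ks' mult.assoc)
qed

text \<open>An integral over a box is computed one coordinate at a time, and each inner integral is
  at most the side length times a maximal function. The coordinates outside \<open>ks\<close> stay
  frozen at \<open>x\<close>; the induction needs this form because the remaining coordinates are
  estimated at the points \<open>x(k := y)\<close> with \<open>y\<close> in the \<open>k\<close>-th
  side.\<close>

lemma nn_integral_box_le_strong_max:
  fixes f :: "('i::finite \<Rightarrow> real) \<Rightarrow> ennreal"
  assumes f [measurable]: "f \<in> borel_measurable lborel_fun" and G: "\<And>k. finite (G k)"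
    and "distinct ks" and ab: "\<And>k. k \<in> set ks \<Longrightarrow> (a k, b k) \<in> G k \<and> a k < b k"
    and x: "\<And>k. k \<in> set ks \<Longrightarrow> a k < x k \<and> x k < b k"
  shows "(\<integral>\<^sup>+z. f (override_on x z (set ks)) * (\<Prod>k\<in>set ks. indicator {a k<..<b k} (z k))
      \<partial>Pi\<^sub>M (set ks) (\<lambda>_. lborel)) \<le>
    (\<Prod>k\<in>set ks. ennreal (b k - a k)) * strong_max G ks f x"
  using assms(3-)
proof (induction ks arbitrary: x)
  case Nil
  show ?case by (simp add: strong_max_def PiM_empty nn_integral_count_space_finite)
next
  case (Cons k ks)
  interpret product_sigma_finite "\<lambda>_::'i. lborel :: real measure" ..
  let ?S = "set ks"
  let ?w = "\<lambda>z. \<Prod>j\<in>?S. indicator {a j<..<b j} (z j) :: ennreal"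
  have k: "k \<notin> ?S" using Cons.prems by auto
  define g where "g = strong_max G ks f"
  have g [measurable]: "g \<in> borel_measurable lborel_fun"
    unfolding g_def by (rule measurable_strong_max[OF f G])
  define c where "c = (\<Prod>j\<in>?S. ennreal (b j - a j))"
  have [measurable]: "(\<lambda>z. override_on x z A) \<in> Pi\<^sub>M A (\<lambda>_. lborel) \<rightarrow>\<^sub>M lborel_fun" for A and x :: "'i \<Rightarrow> real"
  proof (rule measurable_PiM_single')
    show "(\<lambda>z. override_on x z A i) \<in> Pi\<^sub>M A (\<lambda>_. lborel) \<rightarrow>\<^sub>M lborel" for i
      by (cases "i \<in> A") (auto simp: override_on_def)
  qed (auto simp: space_PiM)
  have upd: "override_on x (z(k := y)) (insert k ?S) = override_on (x(k := y)) z ?S" for z y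
    using k by (auto simp: override_on_def)
  have "(\<integral>\<^sup>+z. f (override_on x z (insert k ?S)) * (\<Prod>j\<in>insert k ?S. indicator {a j<..<b j} (z j))
      \<partial>Pi\<^sub>M (insert k ?S) (\<lambda>_. lborel)) =
    (\<integral>\<^sup>+y. \<integral>\<^sup>+z. f (override_on x (z(k := y)) (insert k ?S)) *
      (\<Prod>j\<in>insert k ?S. indicator {a j<..<b j} ((z(k := y)) j)) \<partial>Pi\<^sub>M ?S (\<lambda>_. lborel) \<partial>lborel)"
    using k by (intro product_nn_integral_insert_rev) (simp, simp, measurable)
  also have "\<dots> = (\<integral>\<^sup>+y. \<integral>\<^sup>+z. indicator {a k<..<b k} y * (f (override_on (x(k := y)) z ?S) * ?w z)
      \<partial>Pi\<^sub>M ?S (\<lambda>_. lborel) \<partial>lborel)"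
  proof (intro nn_integral_cong, unfold upd)
    fix y :: real and z :: "'i \<Rightarrow> real"
    have "(\<Prod>j\<in>?S. indicator {a j<..<b j} ((z(k := y)) j)) = ?w z"
      using k by (intro prod.cong) auto
    then show "f (override_on (x(k := y)) z ?S) * (\<Prod>j\<in>insert k ?S. indicator {a j<..<b j} ((z(k := y)) j)) =
        indicator {a k<..<b k} y * (f (override_on (x(k := y)) z ?S) * ?w z)"
      using k by (simp add: mult_ac)
  qed
  also have "\<dots> \<le> (\<integral>\<^sup>+y. indicator {a k<..<b k} y * (c * g (x(k := y))) \<partial>lborel)"
  proof (intro nn_integral_mono)
    fix y :: real
    have "(\<integral>\<^sup>+z. f (override_on (x(k := y)) z ?S) * ?w z \<partial>Pi\<^sub>M ?S (\<lambda>_. lborel)) \<le> c * g (x(k := y))"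
      unfolding c_def g_def using Cons.prems k by (intro Cons.IH) auto
    then show "(\<integral>\<^sup>+z. indicator {a k<..<b k} y * (f (override_on (x(k := y)) z ?S) * ?w z)
        \<partial>Pi\<^sub>M ?S (\<lambda>_. lborel)) \<le> indicator {a k<..<b k} y * (c * g (x(k := y)))"
      by (subst nn_integral_cmult) (measurable, auto intro: mult_left_mono)
  qed
  also have "\<dots> = (\<integral>\<^sup>+y. c * (g (x(k := y)) * indicator {a k<..<b k} y) \<partial>lborel)"
    by (simp add: mult_ac)
  also have "\<dots> = c * (\<integral>\<^sup>+y\<in>{a k<..<b k}. g (x(k := y)) \<partial>lborel)"
    by (rule nn_integral_cmult) measurable
  also have "\<dots> \<le> c * (ennreal (b k - a k) * coord_max (G k) k g x)"
  proof (intro mult_left_mono)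
    let ?A = "\<integral>\<^sup>+y\<in>{a k<..<b k}. g (x(k := y)) \<partial>lborel"
    have ab: "(a k, b k) \<in> G k" "a k < b k" "a k < x k" "x k < b k" using Cons.prems by auto
    have "?A / ennreal (b k - a k) \<le> coord_max (G k) k g x"
      unfolding coord_max_def using ab by (intro SUP_upper2[OF ab(1)]) simp
    then have "ennreal (b k - a k) * (?A / ennreal (b k - a k)) \<le> ennreal (b k - a k) * coord_max (G k) k g x"
      by (rule mult_left_mono) simp
    moreover have "ennreal (b k - a k) * (?A / ennreal (b k - a k)) = ?A"
      using ab by (subst mult.commute, subst ennreal_divide_times) (simp add: ennreal_divide_self)
    ultimately show "?A \<le> ennreal (b k - a k) * coord_max (G k) k g x" by simp
  qed simp
  finally show ?case
    using k by (simp add: c_def g_def strong_max_def mult_ac)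
qed

lemma box_family_weak_type_fun:
  fixes f :: "('i::finite \<Rightarrow> real) \<Rightarrow> ennreal" and B :: "(('i \<Rightarrow> real) \<times> ('i \<Rightarrow> real)) set"
  assumes f [measurable]: "f \<in> borel_measurable lborel_fun" and B: "finite B"
    and pos: "\<And>a b k. (a, b) \<in> B \<Longrightarrow> a k < b k"
    and avg: "\<And>a b. (a, b) \<in> B \<Longrightarrow> (\<Prod>k\<in>UNIV. ennreal (b k - a k)) <
      (\<integral>\<^sup>+z\<in>{z. \<forall>k. a k < z k \<and> z k < b k}. f z \<partial>lborel_fun)"
  shows "emeasure lborel_fun (\<Union>(a, b)\<in>B. {z. \<forall>k. a k < z k \<and> z k < b k}) \<le>
    12 ^ CARD('i) *
      (\<integral>\<^sup>+x. dyadic_log (CARD('i) - 1) (ennreal (1 / 2 ^ CARD('i))) (f x) \<partial>lborel_fun)"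
proof -
  obtain ks :: "'i list" where ks: "set ks = UNIV" "distinct ks"
    using finite_distinct_list[of "UNIV :: 'i set"] by auto
  have len: "length ks = CARD('i)" using ks by (metis distinct_card)
  then have ne: "ks \<noteq> []" by auto
  \<comment> \<open>\<open>G k\<close> collects the \<open>k\<close>-th sides of all boxes. The
    composed operator thus also combines sides of different boxes, which only makes it
    larger.\<close>
  define G where "G k = (\<lambda>p. (fst p k, snd p k)) ` B" for k
  have finG: "finite (G k)" for k using B by (simp add: G_def)
  have posG: "fst I < snd I" if "I \<in> G k" for I k using that pos by (auto simp: G_def)
  note [measurable] = measurable_strong_max[OF f finG]
  have meas: "{x. 1 < strong_max G ks f x} \<in> sets lborel_fun"
  proof -
    have "{x \<in> space lborel_fun. 1 < strong_max G ks f x} \<in> sets lborel_fun" by measurable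
    then show ?thesis by (simp add: space_PiM)
  qed
  have "(\<Union>(a, b)\<in>B. {z. \<forall>k. a k < z k \<and> z k < b k}) \<subseteq> {x. 1 < strong_max G ks f x}"
  proof safe
    fix a b x assume ab: "(a, b) \<in> B" and x: "\<forall>k. a k < x k \<and> x k < b k"
    have "(\<integral>\<^sup>+z\<in>{z. \<forall>k. a k < z k \<and> z k < b k}. f z \<partial>lborel_fun) =
        (\<integral>\<^sup>+z. f (override_on x z (set ks)) * (\<Prod>k\<in>set ks. indicator {a k<..<b k} (z k))
          \<partial>Pi\<^sub>M (set ks) (\<lambda>_. lborel))"
      unfolding ks(1)
      by (intro nn_integral_cong) (auto simp: override_on_def indicator_def prod_zero_iff)
    also have "\<dots> \<le> (\<Prod>k\<in>set ks. ennreal (b k - a k)) * strong_max G ks f x"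
      using ab x pos
      by (intro nn_integral_box_le_strong_max f finG ks) (auto simp: G_def intro!: image_eqI[of _ _ "(a, b)"])
    finally have "(\<Prod>k\<in>UNIV. ennreal (b k - a k)) * 1 < (\<Prod>k\<in>UNIV. ennreal (b k - a k)) * strong_max G ks f x"
      using avg[OF ab] ks by simp
    then show "1 < strong_max G ks f x"
      by (meson leD leI mult_left_mono zero_le)
  qed
  then have "emeasure lborel_fun (\<Union>(a, b)\<in>B. {z. \<forall>k. a k < z k \<and> z k < b k}) \<le>
      emeasure lborel_fun {x. 1 < strong_max G ks f x}"
    using meas by (rule emeasure_mono)
  also have "\<dots> \<le> 12 ^ length ks *
      (\<integral>\<^sup>+x. dyadic_log (length ks - 1) (ennreal (1 / 2 ^ length ks)) (f x) \<partial>lborel_fun)"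
    by (rule strong_max_weak_type[OF f finG posG ne])
  finally show ?thesis by (simp only: len)
qed

section \<open>Lebesgue measure on vectors as a product measure\<close>

lemma lborel_eq_distr_vec_lambda:
  "(lborel :: (real ^ 'n) measure) = distr lborel_fun borel vec_lambda"
proof (rule lborel_eqI)
  interpret product_sigma_finite "\<lambda>_::'n. lborel :: real measure" ..
  have meas: "vec_lambda \<in> lborel_fun \<rightarrow>\<^sub>M (borel :: (real ^ 'n) measure)"
    by (subst borel_measurable_euclidean_space) (auto simp: Basis_vec_def inner_axis)
  fix l u :: "real ^ 'n"
  assume lu: "\<And>b. b \<in> Basis \<Longrightarrow> l \<bullet> b \<le> u \<bullet> b"
  have le: "l $ k \<le> u $ k" for k
    using lu[of "axis k 1"] by (auto simp: inner_axis Basis_vec_def)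
  have "emeasure (distr lborel_fun borel vec_lambda) (box l u) =
      emeasure lborel_fun (vec_lambda -` box l u \<inter> space lborel_fun)"
    by (rule emeasure_distr[OF meas]) simp
  also have "vec_lambda -` box l u \<inter> space lborel_fun = Pi\<^sub>E UNIV (\<lambda>k. {l $ k<..<u $ k})"
    by (auto simp: mem_box_cart space_PiM PiE_iff)
  also have "emeasure lborel_fun \<dots> = (\<Prod>k\<in>UNIV. emeasure lborel {l $ k<..<u $ k})"
    by (rule emeasure_PiM) auto
  also have "\<dots> = ennreal (\<Prod>k\<in>UNIV. u $ k - l $ k)"
    using le by (simp add: prod_ennreal)
  also have "(\<Prod>k\<in>UNIV. u $ k - l $ k) = (\<Prod>b\<in>Basis. (u - l) \<bullet> b)"
  proof -
    have "(\<Prod>b\<in>Basis. (u - l) \<bullet> b) = (\<Prod>k\<in>UNIV. (u - l) \<bullet> axis k 1)"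
      by (rule prod.reindex_cong[of "\<lambda>k. axis k 1"]) (auto simp: Basis_vec_def inj_on_def axis_eq_axis)
    then show ?thesis by (simp add: inner_axis)
  qed
  finally show "emeasure (distr lborel_fun borel vec_lambda) (box l u) = ennreal (\<Prod>b\<in>Basis. (u - l) \<bullet> b)" .
qed simp

section \<open>The Young function\<close>

lemma add_power_le:
  fixes a b :: real
  assumes "0 \<le> a" "0 \<le> b"
  shows "(a + b) ^ p \<le> 2 ^ p * (a ^ p + b ^ p)"
proof -
  have "(a + b) ^ p \<le> (2 * max a b) ^ p" using assms by (intro power_mono) auto
  also have "\<dots> = 2 ^ p * max a b ^ p" by (simp add: power_mult_distrib)
  also have "\<dots> \<le> 2 ^ p * (a ^ p + b ^ p)" using assms by (intro mult_left_mono) (auto simp: max_def)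
  finally show ?thesis .
qed

lemma log_plus_nonneg [simp]: "0 \<le> log_plus t"
  by (simp add: log_plus_def)

lemma log_plus_mono: "t \<le> u \<Longrightarrow> log_plus t \<le> log_plus u"
  by (auto simp: log_plus_def max.coboundedI1)

lemma log_plus_mult: "0 \<le> a \<Longrightarrow> 0 \<le> b \<Longrightarrow> log_plus (a * b) \<le> log_plus a + log_plus b"
  by (auto simp: log_plus_def ln_mult mult_le_0_iff)

lemma ln_le_log_plus: "0 < t \<Longrightarrow> ln t \<le> log_plus t"
  by (simp add: log_plus_def)

lemma measurable_log_plus [measurable]: "log_plus \<in> borel_measurable borel"
  unfolding log_plus_def by measurable

text \<open>The quotient of \<open>Phi n t\<close> by \<open>t\<close>. For n = 1 it is the constant
  2, because a power with exponent 0 is 1; this accounts for some extra factors 2 below.\<close>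

definition log_factor :: "nat \<Rightarrow> real \<Rightarrow> real"
  where "log_factor n t = 1 + log_plus t ^ (n - 1)"

lemma Phi_eq: "Phi n t = t * log_factor n t"
  by (simp add: Phi_def log_factor_def)

lemma log_factor_ge_1 [simp]: "1 \<le> log_factor n t"
  by (simp add: log_factor_def)

lemma log_factor_pos [simp]: "0 < log_factor n t"
  by (rule less_le_trans[OF zero_less_one log_factor_ge_1])

lemma log_factor_nonneg [simp]: "0 \<le> log_factor n t"
  by (rule less_imp_le) simp

lemma log_factor_mono: "t \<le> u \<Longrightarrow> log_factor n t \<le> log_factor n u"
  by (simp add: log_factor_def log_plus_mono power_mono)

lemma log_factor_mult:
  assumes "0 \<le> a" "0 \<le> b"
  shows "log_factor n (a * b) \<le> 2 ^ (n - 1) * log_factor n a * log_factor n b"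
proof -
  let ?p = "n - 1" and ?x = "log_plus a ^ (n - 1)" and ?y = "log_plus b ^ (n - 1)"
  have one: "1 \<le> (2::real) ^ ?p" by simp
  have "log_plus (a * b) ^ ?p \<le> (log_plus a + log_plus b) ^ ?p"
    using assms by (intro power_mono log_plus_mult) auto
  also have "\<dots> \<le> 2 ^ ?p * (?x + ?y)" by (rule add_power_le) auto
  finally have "log_factor n (a * b) \<le> 2 ^ ?p * 1 + 2 ^ ?p * (?x + ?y)"
    using one unfolding log_factor_def by linarith
  also have "\<dots> \<le> 2 ^ ?p * 1 + 2 ^ ?p * (?x + ?y) + 2 ^ ?p * (?x * ?y)" by simp
  also have "\<dots> = 2 ^ ?p * log_factor n a * log_factor n b"
    by (simp add: log_factor_def algebra_simps)
  finally show ?thesis .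
qed

lemma measurable_Phi [measurable]: "Phi n \<in> borel_measurable borel"
  unfolding Phi_def by measurable

lemma Phi_0 [simp]: "Phi n 0 = 0"
  by (simp add: Phi_def)

lemma Phi_ge: "0 \<le> t \<Longrightarrow> t \<le> Phi n t"
  using mult_left_mono[OF log_factor_ge_1, of t n t] by (simp add: Phi_eq)

lemma Phi_mono: "0 \<le> t \<Longrightarrow> t \<le> u \<Longrightarrow> Phi n t \<le> Phi n u"
  unfolding Phi_eq by (intro mult_mono log_factor_mono) auto

lemma Phi_mult:
  assumes "0 \<le> a" "0 \<le> b"
  shows "Phi n (a * b) \<le> 2 ^ (n - 1) * Phi n a * Phi n b"
proof -
  have "(a * b) * log_factor n (a * b) \<le> (a * b) * (2 ^ (n - 1) * log_factor n a * log_factor n b)"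
    using assms by (intro mult_left_mono log_factor_mult) auto
  then show ?thesis by (simp add: Phi_eq mult_ac)
qed

lemma measurable_Phi_iter [measurable]: "(Phi n ^^ m) \<in> borel_measurable borel"
  by (induction m) (auto intro: measurable_comp[OF _ measurable_Phi])

lemma Phi_iter_ge: "0 \<le> t \<Longrightarrow> t \<le> (Phi n ^^ m) t"
proof (induction m)
  case (Suc m)
  then show ?case using Phi_ge[of "(Phi n ^^ m) t" n] by simp
qed simp

lemma Phi_iter_nonneg: "0 \<le> t \<Longrightarrow> 0 \<le> (Phi n ^^ m) t"
  using Phi_iter_ge order_trans by blast

text \<open>Serves to pull a power of the measure out of the integrals in the fractional case. The
  constant for the inner iterates ends up inside the next application of \<open>Phi n\<close>, which
  is why \<open>Phi n C\<close> occurs.\<close>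

lemma Phi_iter_mult:
  "\<exists>C>0. \<forall>a\<ge>0. \<forall>b\<ge>0. (Phi n ^^ m) (a * b) \<le> C * (Phi n ^^ m) a * (Phi n ^^ m) b"
proof (induction m)
  case 0
  show ?case by (auto intro: exI[of _ 1])
next
  case (Suc m)
  then obtain C where C: "C > 0" "\<And>a b. 0 \<le> a \<Longrightarrow> 0 \<le> b \<Longrightarrow>
    (Phi n ^^ m) (a * b) \<le> C * (Phi n ^^ m) a * (Phi n ^^ m) b" by blast
  let ?K = "2 ^ (n - 1) :: real"
  show ?case
  proof (intro exI conjI allI impI)
    show "?K * ?K * Phi n C > 0" using C(1) Phi_ge[of C n] by simp
    fix a b :: real assume ab: "0 \<le> a" "0 \<le> b"
    define A B where "A = (Phi n ^^ m) a" and "B = (Phi n ^^ m) b"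
    have AB: "0 \<le> A" "0 \<le> B" using ab by (auto simp: A_def B_def Phi_iter_nonneg)
    have "(Phi n ^^ Suc m) (a * b) \<le> Phi n (C * A * B)"
      using C(2)[OF ab] ab by (auto intro!: Phi_mono Phi_iter_nonneg simp: A_def B_def)
    also have "\<dots> \<le> ?K * Phi n (C * A) * Phi n B" using AB C(1) by (intro Phi_mult) auto
    also have "\<dots> \<le> ?K * (?K * Phi n C * Phi n A) * Phi n B"
      using AB C(1) order_trans[OF _ Phi_ge[of B n]]
      by (intro mult_right_mono mult_left_mono Phi_mult) auto
    finally show "(Phi n ^^ Suc m) (a * b) \<le> ?K * ?K * Phi n C * (Phi n ^^ Suc m) a * (Phi n ^^ Suc m) b"
      by (simp add: A_def B_def mult_ac)
  qed
qed

text \<open>Apart from the weight the terms grow geometrically, so the sum is of the order of its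
  last term. The threshold is what n halvings of 1 leave, and above it the last index is less than
  \<open>real n + 2 * log_plus t\<close>.\<close>

lemma dyadic_log_le_Phi:
  fixes n :: nat and t :: real
  assumes n: "1 \<le> n"
  shows "dyadic_log (n - 1) (ennreal (1 / 2 ^ n)) (ennreal t) \<le>
    ennreal (2 * (real n + 3) ^ (n - 1) * 2 ^ (n - 1) * Phi n t)"
proof (cases "t \<le> 1 / 2 ^ n")
  case True
  then show ?thesis by (simp add: dyadic_log_eq_0 ennreal_leI)
next
  case False
  define s :: real where "s = 1 / 2 ^ n"
  have s: "0 < s" "s < t" using False by (auto simp: s_def)
  let ?p = "n - 1"
  obtain K where K: "ennreal s * 2 ^ K < ennreal t"
    "\<And>k. indicator {ennreal s * 2 ^ k<..} (ennreal t) = (if k \<le> K then 1 else (0 :: ennreal))"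
    using dyadic_level_obtain[of "ennreal s" "ennreal t"] s by (auto simp: ennreal_less_iff)
  have pw: "ennreal s * 2 ^ k = ennreal (s * 2 ^ k)" for k :: nat
    using s by (simp add: ennreal_mult ennreal_power[symmetric])
  have K': "s * 2 ^ K < t" using K(1) s unfolding pw by (simp add: ennreal_less_iff)
  have "(2::real) ^ K < 2 ^ n * t" using K' by (simp add: s_def field_simps)
  then have "ln ((2::real) ^ K) < ln (2 ^ n * t)" using s by (subst ln_less_cancel_iff) auto
  then have "real K * ln 2 < real n * ln 2 + ln t" using s by (simp add: ln_mult ln_realpow)
  also have "\<dots> \<le> real n * ln 2 + log_plus t * (2 * ln 2)"
  proof -
    \<comment> \<open>A nonnegative binary logarithm is at most twice the natural one.\<close>
    have "1 \<le> 2 * ln (2::real)" using ln2_ge_two_thirds by linarith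
    then have "log_plus t * 1 \<le> log_plus t * (2 * ln 2)" by (intro mult_left_mono) auto
    then show ?thesis using ln_le_log_plus[of t] s by linarith
  qed
  also have "\<dots> = (real n + 2 * log_plus t) * ln 2" by (simp add: algebra_simps)
  finally have "real K < real n + 2 * log_plus t" by simp
  also have "\<dots> + 1 \<le> (real n + 3) * (1 + log_plus t)"
    by (simp add: algebra_simps)
  finally have "real (K + 1) \<le> (real n + 3) * (1 + log_plus t)" by simp
  then have "real (K + 1) ^ ?p \<le> ((real n + 3) * (1 + log_plus t)) ^ ?p"
    by (intro power_mono) auto
  also have "\<dots> = (real n + 3) ^ ?p * (1 + log_plus t) ^ ?p" by (simp add: power_mult_distrib)
  also have "\<dots> \<le> (real n + 3) ^ ?p * (2 ^ ?p * (1 ^ ?p + log_plus t ^ ?p))"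
    by (intro mult_left_mono add_power_le) auto
  finally have Kp: "real (K + 1) ^ ?p \<le> (real n + 3) ^ ?p * 2 ^ ?p * log_factor n t"
    by (simp add: log_factor_def mult.assoc)
  have "dyadic_log ?p (ennreal s) (ennreal t) =
      (\<Sum>k\<le>K. ennreal s * 2 ^ k * of_nat ((k + 1) ^ ?p))"
    unfolding dyadic_log_def
    by (subst suminf_finite[of "{..K}"]) (auto simp: K(2) intro!: sum.cong)
  also have "\<dots> = (\<Sum>k\<le>K. ennreal (s * 2 ^ k * real (k + 1) ^ ?p))"
  proof (intro sum.cong refl)
    fix k
    have "of_nat ((k + 1) ^ ?p) = ennreal (real (k + 1) ^ ?p)"
      by (metis ennreal_of_nat_eq_real_of_nat of_nat_power)
    then show "ennreal s * 2 ^ k * of_nat ((k + 1) ^ ?p) = ennreal (s * 2 ^ k * real (k + 1) ^ ?p)"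
      using s unfolding pw by (subst ennreal_mult) auto
  qed
  also have "\<dots> = ennreal (\<Sum>k\<le>K. s * 2 ^ k * real (k + 1) ^ ?p)"
    using s by (intro sum_ennreal) auto
  also have "\<dots> \<le> ennreal (2 * t * real (K + 1) ^ ?p)"
  proof (rule ennreal_leI)
    have "(\<Sum>k\<le>K. s * 2 ^ k * real (k + 1) ^ ?p) \<le> (\<Sum>k\<le>K. s * 2 ^ k * real (K + 1) ^ ?p)"
      using s by (intro sum_mono mult_left_mono power_mono) auto
    also have "\<dots> = s * (\<Sum>k\<le>K. 2 ^ k) * real (K + 1) ^ ?p"
      by (simp add: sum_distrib_left sum_distrib_right)
    also have "(\<Sum>k\<le>K. (2::real) ^ k) \<le> 2 * 2 ^ K"
      by (induction K) auto
    then have "s * (\<Sum>k\<le>K. 2 ^ k) * real (K + 1) ^ ?p \<le> s * (2 * 2 ^ K) * real (K + 1) ^ ?p"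
      using s by (intro mult_right_mono mult_left_mono) auto
    also have "\<dots> \<le> 2 * t * real (K + 1) ^ ?p"
      using K' by (intro mult_right_mono) auto
    finally show "(\<Sum>k\<le>K. s * 2 ^ k * real (k + 1) ^ ?p) \<le> 2 * t * real (K + 1) ^ ?p" .
  qed
  also have "\<dots> \<le> ennreal (2 * t * ((real n + 3) ^ ?p * 2 ^ ?p * log_factor n t))"
    using Kp s by (intro ennreal_leI mult_left_mono) auto
  finally show ?thesis by (simp add: s_def Phi_eq mult_ac)
qed

lemma measure_lebesgue_box_cart:
  fixes a b :: "real ^ 'n"
  assumes "\<And>k. a $ k \<le> b $ k"
  shows "measure lebesgue (box a b) = (\<Prod>k\<in>UNIV. b $ k - a $ k)"
proof -
  have "measure lborel (cbox a b) = (\<Prod>k\<in>UNIV. b $ k - a $ k)"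
    using assms by (intro content_cbox_cart) (simp add: interval_ne_empty_cart)
  moreover have "measure lebesgue (box a b) = measure lborel (cbox a b)"
    by (simp only: measure_completion sets_lborel borel_open open_box measure_lborel_box_eq measure_lborel_cbox_eq)
  ultimately show ?thesis by simp
qed

lemma box_family_weak_type:
  fixes f :: "real ^ 'n \<Rightarrow> real" and B :: "((real ^ 'n) \<times> (real ^ 'n)) set"
  assumes f: "f \<in> borel_measurable lebesgue" and B: "finite B"
    and pos: "\<And>a b k. (a, b) \<in> B \<Longrightarrow> a $ k < b $ k"
    and avg: "\<And>a b. (a, b) \<in> B \<Longrightarrow>
      ennreal (measure lebesgue (box a b)) < (\<integral>\<^sup>+y\<in>box a b. ennreal (f y) \<partial>lebesgue)"
  shows "emeasure lebesgue (\<Union>(a, b)\<in>B. box a b) \<le>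
    12 ^ CARD('n) * ennreal (2 * (real CARD('n) + 3) ^ (CARD('n) - 1) * 2 ^ (CARD('n) - 1)) *
      (\<integral>\<^sup>+y. ennreal (Phi CARD('n) (f y)) \<partial>lebesgue)"
proof -
  let ?N = "CARD('n)"
  define c where "c = 2 * (real ?N + 3) ^ (?N - 1) * 2 ^ (?N - 1)"
  have c: "0 \<le> c" by (simp add: c_def)
  \<comment> \<open>The product measure on coordinate functions is not completed, so a Borel
    function equal to \<open>f\<close> almost everywhere takes its place; the integrals
    agree.\<close>
  obtain g where g [measurable]: "g \<in> borel_measurable lborel" and fg: "AE y in lborel. f y = g y"
    using completion_ex_borel_measurable_real[OF f] by auto
  have vec [measurable]: "vec_lambda \<in> lborel_fun \<rightarrow>\<^sub>M (borel :: (real ^ 'n) measure)"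
    by (subst borel_measurable_euclidean_space) (auto simp: Basis_vec_def inner_axis)
  have transfer: "(\<integral>\<^sup>+y. h y \<partial>lborel) = (\<integral>\<^sup>+x. h (vec_lambda x) \<partial>lborel_fun)"
    if "h \<in> borel_measurable borel" for h :: "real ^ 'n \<Rightarrow> ennreal"
    by (subst lborel_eq_distr_vec_lambda) (rule nn_integral_distr[OF vec], simp add: that)
  define B' where "B' = map_prod vec_nth vec_nth ` B"
  define F where "F x = ennreal (g (vec_lambda x))" for x
  have F [measurable]: "F \<in> borel_measurable lborel_fun"
    unfolding F_def using g by measurable
  have box_eq: "vec_lambda z \<in> box a b \<longleftrightarrow> (\<forall>k. a $ k < z k \<and> z k < b $ k)" for a b :: "real ^ 'n" and z
    by (simp add: mem_box_cart)
  have int_eq: "(\<integral>\<^sup>+y\<in>box a b. ennreal (f y) \<partial>lebesgue) =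
      (\<integral>\<^sup>+z\<in>{z. \<forall>k. a $ k < z k \<and> z k < b $ k}. F z \<partial>lborel_fun)" for a b
  proof -
    have "(\<integral>\<^sup>+y\<in>box a b. ennreal (f y) \<partial>lebesgue) = (\<integral>\<^sup>+y\<in>box a b. ennreal (g y) \<partial>lborel)"
      unfolding nn_integral_completion using fg by (intro nn_integral_cong_AE) auto
    also have "\<dots> = (\<integral>\<^sup>+x. ennreal (g (vec_lambda x)) * indicator (box a b) (vec_lambda x) \<partial>lborel_fun)"
      using g by (intro transfer) auto
    finally show ?thesis by (simp add: F_def indicator_def box_eq)
  qed
  have vol: "ennreal (measure lebesgue (box a b)) = (\<Prod>k\<in>UNIV. ennreal (b $ k - a $ k))"
    if "(a, b) \<in> B" for a b
    using pos[OF that] by (subst measure_lebesgue_box_cart) (auto simp: prod_ennreal less_imp_le)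
  let ?U = "\<Union>(a, b)\<in>B'. {z. \<forall>k. a k < z k \<and> z k < b k}"
  let ?V = "\<Union>(a, b)\<in>B. box a b"
  have "?V \<in> sets lborel" using B by (auto intro!: sets.finite_UN)
  then have "emeasure lebesgue ?V = emeasure lborel ?V" by simp
  also have "\<dots> = emeasure lborel_fun (vec_lambda -` ?V \<inter> space lborel_fun)"
    using B by (subst lborel_eq_distr_vec_lambda, subst emeasure_distr) (auto intro!: sets.finite_UN)
  also have "vec_lambda -` ?V \<inter> space lborel_fun = ?U"
    by (simp add: B'_def box_eq space_PiM vimage_def case_prod_beta) blast
  also have "emeasure lborel_fun ?U \<le> 12 ^ ?N *
      (\<integral>\<^sup>+x. dyadic_log (?N - 1) (ennreal (1 / 2 ^ ?N)) (F x) \<partial>lborel_fun)"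
  proof (rule box_family_weak_type_fun[OF F])
    show "finite B'" using B by (simp add: B'_def)
    show "a k < b k" if "(a, b) \<in> B'" for a b k using that pos by (auto simp: B'_def)
    show "(\<Prod>k\<in>UNIV. ennreal (b k - a k)) < (\<integral>\<^sup>+z\<in>{z. \<forall>k. a k < z k \<and> z k < b k}. F z \<partial>lborel_fun)"
      if "(a, b) \<in> B'" for a b
      using that avg by (auto simp: B'_def vol[symmetric] int_eq[symmetric])
  qed
  also have "\<dots> \<le> 12 ^ ?N * (\<integral>\<^sup>+x. ennreal (c * Phi ?N (g (vec_lambda x))) \<partial>lborel_fun)"
    unfolding F_def c_def by (intro mult_left_mono nn_integral_mono dyadic_log_le_Phi) auto
  also have "(\<integral>\<^sup>+x. ennreal (c * Phi ?N (g (vec_lambda x))) \<partial>lborel_fun) =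
      (\<integral>\<^sup>+y. ennreal (c * Phi ?N (g y)) \<partial>lborel)"
    using g by (intro transfer[symmetric]) auto
  also have "\<dots> = (\<integral>\<^sup>+y. ennreal c * ennreal (Phi ?N (f y)) \<partial>lborel)"
    using fg c by (intro nn_integral_cong_AE) (auto simp: ennreal_mult')
  also have "\<dots> = (\<integral>\<^sup>+y. ennreal c * ennreal (Phi ?N (f y)) \<partial>lebesgue)"
    by (simp add: nn_integral_completion)
  also have "\<dots> = ennreal c * (\<integral>\<^sup>+y. ennreal (Phi ?N (f y)) \<partial>lebesgue)"
    using f by (intro nn_integral_cmult) measurable
  finally show ?thesis by (simp add: c_def mult.assoc)
qed

section \<open>Products of Luxemburg averages\<close>

lemma Phi_divide_le:
  assumes "1 \<le> \<mu>" "0 \<le> t"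
  shows "Phi n (t / \<mu>) \<le> Phi n t / \<mu>"
proof -
  have "t / \<mu> \<le> t / 1" using assms by (intro divide_left_mono) auto
  then have "t / \<mu> * log_factor n (t / \<mu>) \<le> t / \<mu> * log_factor n t"
    using assms by (intro mult_left_mono log_factor_mono) auto
  then show ?thesis by (simp add: Phi_eq)
qed

text \<open>All iterates are at least \<open>t\<close>, so each application of \<open>Phi n\<close>
  contributes at least the factor \<open>log_factor n t\<close>. This is the source of the gain for
  large norms.\<close>

lemma Phi_iter_ge_log_factor_power:
  assumes "0 \<le> t"
  shows "t * log_factor n t ^ k \<le> (Phi n ^^ k) t"
proof (induction k)
  case (Suc k)
  have "t * log_factor n t ^ Suc k = (t * log_factor n t ^ k) * log_factor n t" by simp
  also have "\<dots> \<le> (Phi n ^^ k) t * log_factor n ((Phi n ^^ k) t)"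
    using assms Suc by (intro mult_mono log_factor_mono Phi_iter_ge Phi_iter_nonneg) auto
  also have "\<dots> = (Phi n ^^ Suc k) t" using Phi_eq[of n "(Phi n ^^ k) t"] by simp
  finally show ?case .
qed simp

lemma Phi_le_Phi_iter:
  assumes "0 \<le> t" "1 \<le> m"
  shows "Phi n t \<le> (Phi n ^^ m) t"
proof -
  obtain k where "m = Suc k" using assms(2) by (cases m) auto
  then show ?thesis
    using assms Phi_iter_ge[of t k n] by (simp add: Phi_mono)
qed

text \<open>The factor by which the integral of \<open>\<Phi>\<^sup>m(u)\<close> is compared with the Luxemburg norm \<open>\<mu>\<close> of \<open>u\<close>:
  a loss for small \<open>\<mu>\<close>, a gain for large \<open>\<mu>\<close>.\<close>

definition level_weight :: "nat \<Rightarrow> nat \<Rightarrow> real \<Rightarrow> real"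
  where "level_weight n m \<mu> = (if \<mu> \<le> 1 then 1 / log_factor n (1 / \<mu>) else log_factor n \<mu> ^ (m - 1))"

lemma level_weight_pos: "0 < level_weight n m \<mu>"
  by (simp add: level_weight_def)

lemma log_factor_prod_le:
  assumes "finite S" "\<And>i. i \<in> S \<Longrightarrow> 0 \<le> \<mu> i"
  shows "log_factor n (\<Prod>i\<in>S. \<mu> i) \<le> 2 * (2 ^ (n - 1)) ^ card S * (\<Prod>i\<in>S. log_factor n (\<mu> i))"
  using assms
proof (induction S rule: finite_induct)
  case empty
  \<comment> \<open>For n - 1 = 0 the value \<open>log_factor n 1\<close> is 2 rather than 1; the
    leading 2 in the bound covers this.\<close>
  then show ?case by (cases "n - 1") (auto simp: log_factor_def log_plus_def)
next
  case (insert i S)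
  let ?K = "2 ^ (n - 1) :: real"
  have "log_factor n (\<Prod>j\<in>insert i S. \<mu> j) \<le> ?K * log_factor n (\<mu> i) * log_factor n (\<Prod>j\<in>S. \<mu> j)"
    using insert log_factor_mult[of "\<mu> i" "\<Prod>j\<in>S. \<mu> j" n] by (simp add: prod_nonneg)
  also have "\<dots> \<le> ?K * log_factor n (\<mu> i) * (2 * ?K ^ card S * (\<Prod>j\<in>S. log_factor n (\<mu> j)))"
    using insert by (intro mult_left_mono) auto
  finally show ?case using insert by (simp add: mult_ac)
qed

text \<open>For a small \<open>\<mu> i\<close>, \<open>1 / \<mu> i\<close> is at most the product \<open>P\<close> of the large ones; there are at most
  \<open>m - 1\<close> small ones, and each large one contributes \<open>m - 1\<close> logarithmic factors.\<close>

lemma prod_level_weight_ge: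
  assumes pos: "\<And>i. i < m \<Longrightarrow> 0 < \<mu> i" and prod: "1 < (\<Prod>i<m. \<mu> i)"
  shows "1 \<le> (2 * (2 ^ (n - 1)) ^ m) ^ (m - 1) * (\<Prod>i<m. level_weight n m (\<mu> i))"
proof -
  let ?L = "log_factor n"
  define S T where "S = {i. i < m \<and> 1 < \<mu> i}" and "T = {i. i < m \<and> \<mu> i \<le> 1}"
  have fin: "finite S" "finite T" by (auto simp: S_def T_def)
  have ST: "{..<m} = S \<union> T" "S \<inter> T = {}" by (auto simp: S_def T_def)
  have card: "card S + card T = m" using card_Un_disjoint[OF fin ST(2)] ST(1) by (metis card_lessThan)
  define P where "P = (\<Prod>i\<in>S. \<mu> i)"
  have split: "(\<Prod>i<m. h i) = (\<Prod>i\<in>S. h i) * (\<Prod>i\<in>T. h i)" for h :: "nat \<Rightarrow> real"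
    unfolding ST(1) using fin ST(2) by (rule prod.union_disjoint)
  have T1: "(\<Prod>i\<in>T. \<mu> i) \<le> 1"
    using pos by (intro prod_le_1) (auto simp: T_def intro: less_imp_le)
  have "S \<noteq> {}"
  proof
    assume "S = {}"
    then show False using prod T1 by (simp add: split)
  qed
  then have "1 \<le> card S" using fin by (simp add: Suc_leI card_gt_0_iff)
  then have cardT: "card T \<le> m - 1" using card by simp
  have cardS: "card S \<le> m" using card by simp
  have P: "0 < P" using pos by (auto simp: P_def S_def intro: prod_pos)
  have small: "?L (1 / \<mu> i) \<le> ?L P" if "i \<in> T" for i
  proof (rule log_factor_mono)
    have "(\<Prod>j\<in>T. \<mu> j) = \<mu> i * (\<Prod>j\<in>T - {i}. \<mu> j)" using that fin by (simp add: prod.remove)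
    also have "\<dots> \<le> \<mu> i * 1"
      using that pos by (intro mult_left_mono prod_le_1) (auto simp: T_def intro: less_imp_le)
    finally have "P * (\<Prod>j\<in>T. \<mu> j) \<le> P * \<mu> i" using P by simp
    then have "1 < P * \<mu> i" using prod by (simp add: split P_def)
    then show "1 / \<mu> i \<le> P" using that pos by (simp add: T_def field_simps)
  qed
  define D where "D = 2 * ((2::real) ^ (n - 1)) ^ m"
  define Q where "Q = (\<Prod>i\<in>S. ?L (\<mu> i))"
  have Q: "0 < Q" by (simp add: Q_def prod_pos)
  have "(\<Prod>i\<in>T. ?L (1 / \<mu> i)) \<le> (\<Prod>i\<in>T. ?L P)" using small by (intro prod_mono) auto
  also have "\<dots> \<le> ?L P ^ (m - 1)" using cardT by (simp add: power_increasing)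
  also have "\<dots> \<le> (D * Q) ^ (m - 1)"
  proof (rule power_mono)
    have "?L P \<le> 2 * (2 ^ (n - 1)) ^ card S * Q"
      unfolding P_def Q_def using pos fin by (intro log_factor_prod_le) (auto simp: S_def intro: less_imp_le)
    also have "\<dots> \<le> D * Q"
      unfolding D_def using Q cardS by (intro mult_right_mono mult_left_mono power_increasing) auto
    finally show "?L P \<le> D * Q" .
  qed simp
  finally have le: "(\<Prod>i\<in>T. ?L (1 / \<mu> i)) \<le> D ^ (m - 1) * Q ^ (m - 1)" by (simp add: power_mult_distrib)
  have "(\<Prod>i\<in>S. level_weight n m (\<mu> i)) = Q ^ (m - 1)"
    unfolding Q_def by (subst prod_power_distrib) (auto simp: S_def level_weight_def intro!: prod.cong)
  moreover have "(\<Prod>i\<in>T. level_weight n m (\<mu> i)) = 1 / (\<Prod>i\<in>T. ?L (1 / \<mu> i))"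
    by (subst prod_dividef[symmetric, of "\<lambda>_. 1", simplified])
      (auto simp: T_def level_weight_def inverse_eq_divide intro!: prod.cong)
  ultimately have eq: "(\<Prod>i<m. level_weight n m (\<mu> i)) = Q ^ (m - 1) / (\<Prod>i\<in>T. ?L (1 / \<mu> i))"
    by (simp add: split)
  have "0 < (\<Prod>i\<in>T. ?L (1 / \<mu> i))" by (simp add: prod_pos)
  then have "1 \<le> D ^ (m - 1) * Q ^ (m - 1) / (\<Prod>i\<in>T. ?L (1 / \<mu> i))"
    using le by (subst le_divide_eq_1_pos)
  then show ?thesis by (simp only: eq D_def times_divide_eq_right)
qed

text \<open>A level within a factor 2 of the infimum replaces the exact Luxemburg norm, so it does
  not matter whether the infimum is attained: its half lies below the infimum and is therefore not
  admissible.\<close>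

lemma luxemburg_level_obtain:
  fixes u :: "'a \<Rightarrow> real" and c :: real
  assumes u [measurable]: "u \<in> borel_measurable M" and nonneg: "\<And>x. 0 \<le> u x"
    and pos: "0 < (\<integral>\<^sup>+x. ennreal (u x) \<partial>M)" and fin: "(\<integral>\<^sup>+x. ennreal (Phi n (u x)) \<partial>M) < \<infinity>"
    and c: "0 < c"
  obtains \<mu> :: real where "0 < \<mu>"
    "(\<integral>\<^sup>+x. ennreal (Phi n (u x / \<mu>)) \<partial>M) \<le> ennreal c"
    "ennreal c < (\<integral>\<^sup>+x. ennreal (Phi n (u x / (\<mu> / 2))) \<partial>M)"
proof -
  define I where "I \<mu> = (\<integral>\<^sup>+x. ennreal (Phi n (u x / \<mu>)) \<partial>M)" for \<mu>
  define S where "S = {\<mu>. 0 < \<mu> \<and> I \<mu> \<le> ennreal c}"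
  obtain r where r: "(\<integral>\<^sup>+x. ennreal (Phi n (u x)) \<partial>M) = ennreal r" "0 \<le> r"
    using fin by (cases "\<integral>\<^sup>+x. ennreal (Phi n (u x)) \<partial>M") auto
  have int_le: "(\<integral>\<^sup>+x. ennreal (u x) \<partial>M) \<le> ennreal r"
    unfolding r(1)[symmetric] by (intro nn_integral_mono ennreal_leI Phi_ge nonneg)
  then obtain w where w: "(\<integral>\<^sup>+x. ennreal (u x) \<partial>M) = ennreal w" "0 < w"
    using pos by (cases "\<integral>\<^sup>+x. ennreal (u x) \<partial>M") (auto simp: top_unique)
  \<comment> \<open>Dividing the argument by \<mu> \<ge> 1 divides \<open>Phi n\<close> by at least
    \<mu>, so a level of size at least r / c and 1 is admissible.\<close>
  have ne: "max 1 (r / c) \<in> S"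
  proof -
    define \<mu> where "\<mu> = max 1 (r / c)"
    have \<mu>: "1 \<le> \<mu>" "r / c \<le> \<mu>" by (auto simp: \<mu>_def)
    have "I \<mu> \<le> (\<integral>\<^sup>+x. ennreal (1 / \<mu>) * ennreal (Phi n (u x)) \<partial>M)"
      unfolding I_def
    proof (intro nn_integral_mono)
      fix x
      have "Phi n (u x / \<mu>) \<le> 1 / \<mu> * Phi n (u x)"
        using Phi_divide_le[OF \<mu>(1) nonneg, of n x] by simp
      then show "ennreal (Phi n (u x / \<mu>)) \<le> ennreal (1 / \<mu>) * ennreal (Phi n (u x))"
        using \<mu> by (subst ennreal_mult'[symmetric]) (auto intro: ennreal_leI)
    qed
    also have "\<dots> = ennreal (1 / \<mu>) * ennreal r"
      unfolding r(1)[symmetric] by (intro nn_integral_cmult) measurable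
    also have "\<dots> = ennreal (1 / \<mu> * r)" using \<mu> by (subst ennreal_mult') auto
    also have "\<dots> \<le> ennreal c" using \<mu> c by (intro ennreal_leI) (simp add: field_simps)
    finally show ?thesis using \<mu> by (simp add: S_def \<mu>_def)
  qed
  \<comment> \<open>Since \<open>Phi n t\<close> is at least \<open>t\<close>, no admissible level
    lies below w / c. The positive integral of \<open>u\<close> thus keeps the infimum away from
    0.\<close>
  have lower: "w / c \<le> \<mu>" if "\<mu> \<in> S" for \<mu>
  proof -
    have \<mu>: "0 < \<mu>" "I \<mu> \<le> ennreal c" using that by (auto simp: S_def)
    have "ennreal (1 / \<mu> * w) = (\<integral>\<^sup>+x. ennreal (1 / \<mu>) * ennreal (u x) \<partial>M)"
      using \<mu> by (subst nn_integral_cmult) (auto simp: w ennreal_mult' simp del: times_divide_eq_left)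
    also have "\<dots> \<le> I \<mu>"
      unfolding I_def
    proof (intro nn_integral_mono)
      fix x
      show "ennreal (1 / \<mu>) * ennreal (u x) \<le> ennreal (Phi n (u x / \<mu>))"
        using \<mu> Phi_ge[of "u x / \<mu>" n] nonneg[of x]
        by (subst ennreal_mult'[symmetric]) (auto intro: ennreal_leI)
    qed
    finally have "1 / \<mu> * w \<le> c" using \<mu>(2) c by (meson ennreal_le_iff less_imp_le order_trans)
    then show ?thesis using \<mu> c by (simp add: field_simps)
  qed
  have bdd: "bdd_below S" by (rule bdd_belowI[OF lower])
  have "w / c \<le> Inf S" using ne lower by (intro cInf_greatest) auto
  then have l: "0 < Inf S" using w c by (meson divide_pos_pos less_le_trans)
  obtain \<mu> where \<mu>: "\<mu> \<in> S" "\<mu> < 2 * Inf S"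
    using cInf_lessD[of S "2 * Inf S"] ne l by auto
  have "\<mu> / 2 \<notin> S" using cInf_lower[OF _ bdd, of "\<mu> / 2"] \<mu> by auto
  then show ?thesis using \<mu> by (intro that[of \<mu>]) (auto simp: S_def I_def)
qed

text \<open>For \<mu> \<le> 1, submultiplicativity moves 1 / \<mu> out of \<open>Phi n\<close> and
  loses \<open>log_factor n (1 / \<mu>)\<close>. For \<mu> > 1, the points where
  \<open>Phi n (u x)\<close> is at most a level \<tau> proportional to \<mu> are discarded; at the
  others the m - 1 outer iterates gain at least \<open>log_factor n \<tau> ^ (m - 1)\<close>. The
  total mass V bounds the discarded part. The constant is chosen before the measure, because the
  measure will be the restriction to a varying set.\<close>

lemma Phi_iter_integral_ge:
  fixes \<kappa> :: real
  assumes \<kappa>: "0 < \<kappa>" and m: "1 \<le> m"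
  shows "\<exists>c>0. \<forall>(M :: 'a measure) u V \<mu>. u \<in> borel_measurable M \<longrightarrow> (\<forall>x. 0 \<le> u x) \<longrightarrow>
    0 < V \<longrightarrow> emeasure M (space M) = ennreal V \<longrightarrow> 0 < \<mu> \<longrightarrow>
    ennreal (\<kappa> * V) \<le> (\<integral>\<^sup>+x. ennreal (Phi n (u x / (\<mu> / 2))) \<partial>M) \<longrightarrow>
    ennreal (c * V * \<mu> * level_weight n m \<mu>) \<le> (\<integral>\<^sup>+x. ennreal ((Phi n ^^ m) (u x)) \<partial>M)"
proof -
  let ?L = "log_factor n"
  define K :: real where "K = 2 ^ (n - 1)"
  have K: "0 < K" by (simp add: K_def)
  have Phi2: "0 < Phi n 2" using Phi_ge[of 2 n] by simp
  \<comment> \<open>Submultiplicativity replaces the level \<mu> / 2 by \<mu> at the price of this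
    smaller constant.\<close>
  define \<kappa>' where "\<kappa>' = \<kappa> / (K * Phi n 2)"
  have \<kappa>': "0 < \<kappa>'" using \<kappa> K Phi2 by (simp add: \<kappa>'_def)
  \<comment> \<open>Converts \<open>log_factor n \<tau>\<close> back into
    \<open>log_factor n \<mu>\<close> for \<tau> = \<kappa>' \<mu> / 2, since \<mu> is \<tau> times
    2 / \<kappa>'.\<close>
  define D where "D = (K * ?L (2 / \<kappa>')) ^ (m - 1)"
  have D: "0 < D" using K by (simp add: D_def)
  define c where "c = min (\<kappa>' / K) (\<kappa>' / 2 / D)"
  have c: "0 < c" using \<kappa>' K D by (simp add: c_def)
  show ?thesis
  proof (intro exI[of _ c] conjI c allI impI)
    fix M :: "'a measure" and u V \<mu>
    assume u [measurable]: "u \<in> borel_measurable M" and nn: "\<forall>x. 0 \<le> u x"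
      and V: "0 < V" "emeasure M (space M) = ennreal V" and \<mu>: "0 < (\<mu>::real)"
      and ge: "ennreal (\<kappa> * V) \<le> (\<integral>\<^sup>+x. ennreal (Phi n (u x / (\<mu> / 2))) \<partial>M)"
    have cmult: "(\<integral>\<^sup>+x. ennreal (a * h x) \<partial>M) = ennreal a * (\<integral>\<^sup>+x. ennreal (h x) \<partial>M)"
      if "0 \<le> a" "h \<in> borel_measurable M" for a and h :: "'a \<Rightarrow> real"
      using that by (subst nn_integral_cmult[symmetric]) (auto simp: ennreal_mult')
    have scale: "ennreal (b / a) \<le> X" if "ennreal b \<le> ennreal a * X" "0 < a" for a b :: real and X
    proof (cases X)
      case (real x)
      have "ennreal b \<le> ennreal (a * x)" using that real by (simp add: ennreal_mult')
      then have "b \<le> a * x" using that real by (simp add: ennreal_le_iff)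
      then have "b / a \<le> x" using that by (simp add: field_simps)
      then show ?thesis unfolding real by (rule ennreal_leI)
    qed simp
    let ?F = "\<integral>\<^sup>+x. ennreal ((Phi n ^^ m) (u x)) \<partial>M"
    have "(\<integral>\<^sup>+x. ennreal (Phi n (u x / (\<mu> / 2))) \<partial>M) \<le>
        (\<integral>\<^sup>+x. ennreal (K * Phi n 2 * Phi n (u x / \<mu>)) \<partial>M)"
    proof (intro nn_integral_mono ennreal_leI)
      fix x
      have "Phi n (2 * (u x / \<mu>)) \<le> K * Phi n 2 * Phi n (u x / \<mu>)"
        unfolding K_def using nn \<mu> by (intro Phi_mult) auto
      then show "Phi n (u x / (\<mu> / 2)) \<le> K * Phi n 2 * Phi n (u x / \<mu>)" by (simp add: mult.commute)
    qed
    also have "\<dots> = ennreal (K * Phi n 2) * (\<integral>\<^sup>+x. ennreal (Phi n (u x / \<mu>)) \<partial>M)"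
      using K Phi2 by (intro cmult) auto
    finally have "ennreal (\<kappa> * V / (K * Phi n 2)) \<le> (\<integral>\<^sup>+x. ennreal (Phi n (u x / \<mu>)) \<partial>M)"
      using ge K Phi2 by (intro scale) auto
    then have ge': "ennreal (\<kappa>' * V) \<le> (\<integral>\<^sup>+x. ennreal (Phi n (u x / \<mu>)) \<partial>M)"
      by (simp add: \<kappa>'_def)
    show "ennreal (c * V * \<mu> * level_weight n m \<mu>) \<le> ?F"
    proof (cases "\<mu> \<le> 1")
      case True
      define b where "b = K * Phi n (1 / \<mu>)"
      have b: "0 < b" using K \<mu> Phi_ge[of "1 / \<mu>" n] unfolding b_def
        by (metis divide_pos_pos less_le_trans less_imp_le mult_pos_pos zero_less_one)
      have "(\<integral>\<^sup>+x. ennreal (Phi n (u x / \<mu>)) \<partial>M) \<le> (\<integral>\<^sup>+x. ennreal (b * (Phi n ^^ m) (u x)) \<partial>M)"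
      proof (intro nn_integral_mono ennreal_leI)
        fix x
        have "Phi n (1 / \<mu> * u x) \<le> b * Phi n (u x)"
          unfolding b_def K_def using nn \<mu> by (intro Phi_mult) auto
        also have "\<dots> \<le> b * (Phi n ^^ m) (u x)"
          using b nn m by (intro mult_left_mono Phi_le_Phi_iter) auto
        finally show "Phi n (u x / \<mu>) \<le> b * (Phi n ^^ m) (u x)" by simp
      qed
      also have "\<dots> = ennreal b * ?F" using b by (intro cmult) auto
      finally have "ennreal (\<kappa>' * V) \<le> ennreal b * ?F" using ge' order_trans by blast
      then have "ennreal (\<kappa>' * V / b) \<le> ?F" using b by (rule scale)
      moreover have "\<kappa>' * V / b = \<kappa>' / K * V * \<mu> * level_weight n m \<mu>"
        using True \<mu> by (simp add: b_def level_weight_def Phi_eq)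
      moreover have "c * V * \<mu> * level_weight n m \<mu> \<le> \<kappa>' / K * V * \<mu> * level_weight n m \<mu>"
        using V \<mu> level_weight_pos[of n m \<mu>] by (intro mult_right_mono) (auto simp: c_def)
      ultimately show ?thesis using ennreal_leI order_trans by metis
    next
      case False
      \<comment> \<open>The integral of \<open>Phi n (u x)\<close> is at least \<kappa>' \<mu> V = 2
        \<tau> V, so discarding the values up to \<tau> loses at most half of this lower
        bound.\<close>
      define \<tau> where "\<tau> = \<kappa>' * \<mu> / 2"
      have \<tau>: "0 < \<tau>" using \<kappa>' \<mu> by (simp add: \<tau>_def)
      define l where "l = ?L \<tau> ^ (m - 1)"
      have l: "0 < l" by (simp add: l_def)
      have step: "l * Phi n (u x) \<le> (Phi n ^^ m) (u x) + l * \<tau>" for x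
      proof -
        define v where "v = Phi n (u x)"
        have v: "0 \<le> v" using nn Phi_ge[of "u x" n] order_trans unfolding v_def by blast
        have "(Phi n ^^ m) (u x) = (Phi n ^^ (m - 1)) v"
          using m by (cases m) (auto simp: v_def funpow_swap1)
        moreover have "l * v \<le> (Phi n ^^ (m - 1)) v + l * \<tau>"
        proof (cases "v \<le> \<tau>")
          case True
          then have "l * v \<le> l * \<tau>" using l by simp
          then show ?thesis using Phi_iter_nonneg[OF v, where n = n and m = "m - 1"] by linarith
        next
          case False
          then have "l * v \<le> v * ?L v ^ (m - 1)"
            unfolding l_def using v by (subst mult.commute) (intro mult_left_mono power_mono log_factor_mono, auto)
          also have "\<dots> \<le> (Phi n ^^ (m - 1)) v" by (rule Phi_iter_ge_log_factor_power[OF v])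
          finally show ?thesis using l \<tau> by (simp add: add_increasing2)
        qed
        ultimately show ?thesis by (simp add: v_def)
      qed
      have "ennreal (l * \<mu>) * ennreal (\<kappa>' * V) \<le> ennreal (l * \<mu>) * (\<integral>\<^sup>+x. ennreal (Phi n (u x / \<mu>)) \<partial>M)"
        by (intro mult_left_mono ge') auto
      also have "\<dots> = (\<integral>\<^sup>+x. ennreal (l * \<mu> * Phi n (u x / \<mu>)) \<partial>M)"
        using l \<mu> by (intro cmult[symmetric]) auto
      also have "\<dots> \<le> (\<integral>\<^sup>+x. ennreal (l * Phi n (u x)) \<partial>M)"
      proof (intro nn_integral_mono ennreal_leI)
        fix x
        have "Phi n (u x / \<mu>) \<le> Phi n (u x) / \<mu>" using False nn by (intro Phi_divide_le) auto
        then have "\<mu> * Phi n (u x / \<mu>) \<le> Phi n (u x)" using \<mu> by (simp add: field_simps)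
        then show "l * \<mu> * Phi n (u x / \<mu>) \<le> l * Phi n (u x)" using l by (simp add: mult.assoc)
      qed
      also have "\<dots> \<le> (\<integral>\<^sup>+x. ennreal ((Phi n ^^ m) (u x)) + ennreal (l * \<tau>) \<partial>M)"
      proof (intro nn_integral_mono)
        fix x
        have "ennreal (l * Phi n (u x)) \<le> ennreal ((Phi n ^^ m) (u x) + l * \<tau>)"
          by (rule ennreal_leI[OF step])
        then show "ennreal (l * Phi n (u x)) \<le> ennreal ((Phi n ^^ m) (u x)) + ennreal (l * \<tau>)"
          using nn l \<tau> by (simp add: Phi_iter_nonneg)
      qed
      also have "\<dots> = ?F + ennreal (l * \<tau>) * ennreal V"
        by (subst nn_integral_add) (auto simp: V)
      finally have "ennreal (2 * (l * \<tau> * V)) \<le> ?F + ennreal (l * \<tau> * V)"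
        using l \<mu> \<tau> V \<kappa>' by (simp add: ennreal_mult'[symmetric] \<tau>_def mult_ac)
      moreover have "ennreal (2 * (l * \<tau> * V)) = ennreal (l * \<tau> * V) + ennreal (l * \<tau> * V)"
        using l \<tau> V by (subst ennreal_plus[symmetric]) auto
      ultimately have F: "ennreal (l * \<tau> * V) \<le> ?F"
        by (simp add: add.commute ennreal_add_left_cancel_le)
      have "?L \<mu> \<le> K * ?L \<tau> * ?L (2 / \<kappa>')"
        using log_factor_mult[of \<tau> "2 / \<kappa>'" n] \<tau> \<kappa>' by (simp add: K_def \<tau>_def)
      then have "?L \<mu> ^ (m - 1) \<le> (K * ?L \<tau> * ?L (2 / \<kappa>')) ^ (m - 1)" by (intro power_mono) auto
      also have "\<dots> = l * D" by (simp add: l_def D_def power_mult_distrib mult_ac)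
      finally have "level_weight n m \<mu> \<le> l * D" using False by (simp add: level_weight_def)
      then have "c * V * \<mu> * level_weight n m \<mu> \<le> c * V * \<mu> * (l * D)"
        using c V \<mu> by (intro mult_left_mono) auto
      also have "\<dots> \<le> (\<kappa>' / 2 / D) * V * \<mu> * (l * D)"
        using V \<mu> l D by (intro mult_right_mono) (auto simp: c_def)
      also have "\<dots> = l * \<tau> * V" using D by (simp add: \<tau>_def)
      finally show ?thesis using F ennreal_leI order_trans by metis
    qed
  qed
qed

text \<open>The geometry is condensed into the last premise: for every tuple of levels with product
  at most 1, the linear estimates together account for the whole space. Luxemburg levels of the
  \<open>u i\<close> make that sum too small, so their product must exceed 1, and then the gains of
  the large levels outweigh the losses of the small ones.\<close>

lemma multilinear_weak_type_product:
  fixes A :: real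
  assumes A: "0 < A" and m: "1 \<le> m"
  shows "\<exists>C>0. \<forall>(M :: 'a measure) u V.
    (\<forall>i<m. u i \<in> borel_measurable M \<and> (\<forall>x. 0 \<le> u i x) \<and> 0 < (\<integral>\<^sup>+x. ennreal (u i x) \<partial>M) \<and>
      (\<integral>\<^sup>+x. ennreal ((Phi n ^^ m) (u i x)) \<partial>M) < \<infinity>) \<longrightarrow>
    0 < V \<longrightarrow> emeasure M (space M) = ennreal V \<longrightarrow>
    (\<forall>\<mu>. (\<forall>i<m. 0 < \<mu> i) \<longrightarrow> (\<Prod>i<m. \<mu> i) \<le> 1 \<longrightarrow>
      ennreal V \<le> ennreal A * (\<Sum>i<m. \<integral>\<^sup>+x. ennreal (Phi n (u i x / \<mu> i)) \<partial>M)) \<longrightarrow>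
    ennreal (V ^ m) \<le> ennreal C * (\<Prod>i<m. \<integral>\<^sup>+x. ennreal ((Phi n ^^ m) (u i x)) \<partial>M)"
proof -
  \<comment> \<open>With this value, m integrals of at most \<kappa> V each give A m \<kappa> V = V
    / 2, which contradicts the last premise if the product of the levels is at most 1.\<close>
  define \<kappa> where "\<kappa> = 1 / (2 * A * real m)"
  have \<kappa>: "0 < \<kappa>" using A m by (simp add: \<kappa>_def)
  obtain c where c: "0 < c" and ge: "\<And>(M :: 'a measure) u V \<mu>.
    u \<in> borel_measurable M \<Longrightarrow> (\<And>x. 0 \<le> u x) \<Longrightarrow>
    0 < V \<Longrightarrow> emeasure M (space M) = ennreal V \<Longrightarrow> 0 < \<mu> \<Longrightarrow>
    ennreal (\<kappa> * V) \<le> (\<integral>\<^sup>+x. ennreal (Phi n (u x / (\<mu> / 2))) \<partial>M) \<Longrightarrow>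
    ennreal (c * V * \<mu> * level_weight n m \<mu>) \<le> (\<integral>\<^sup>+x. ennreal ((Phi n ^^ m) (u x)) \<partial>M)"
    using Phi_iter_integral_ge[OF \<kappa> m, where n = n and 'a = 'a] by blast
  define D where "D = (2 * ((2::real) ^ (n - 1)) ^ m) ^ (m - 1)"
  have D: "0 < D" by (simp add: D_def)
  define C where "C = D / c ^ m"
  have C: "0 < C" using c D by (simp add: C_def)
  show ?thesis
  proof (intro exI[of _ C] conjI C allI impI)
    fix M :: "'a measure" and u V
    assume u: "\<forall>i<m. u i \<in> borel_measurable M \<and> (\<forall>x. 0 \<le> u i x) \<and> 0 < (\<integral>\<^sup>+x. ennreal (u i x) \<partial>M) \<and>
        (\<integral>\<^sup>+x. ennreal ((Phi n ^^ m) (u i x)) \<partial>M) < \<infinity>"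
      and V: "0 < V" "emeasure M (space M) = ennreal V"
      and H: "\<forall>\<mu>. (\<forall>i<m. 0 < \<mu> i) \<longrightarrow> (\<Prod>i<m. \<mu> i) \<le> 1 \<longrightarrow>
        ennreal V \<le> ennreal A * (\<Sum>i<m. \<integral>\<^sup>+x. ennreal (Phi n (u i x / \<mu> i)) \<partial>M)"
    have "\<exists>\<mu>. 0 < \<mu> \<and> (\<integral>\<^sup>+x. ennreal (Phi n (u i x / \<mu>)) \<partial>M) \<le> ennreal (\<kappa> * V) \<and>
        ennreal (\<kappa> * V) < (\<integral>\<^sup>+x. ennreal (Phi n (u i x / (\<mu> / 2))) \<partial>M)" if i: "i < m" for i
    proof -
      have "(\<integral>\<^sup>+x. ennreal (Phi n (u i x)) \<partial>M) \<le> (\<integral>\<^sup>+x. ennreal ((Phi n ^^ m) (u i x)) \<partial>M)"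
        using u i m by (intro nn_integral_mono ennreal_leI Phi_le_Phi_iter) auto
      then have "(\<integral>\<^sup>+x. ennreal (Phi n (u i x)) \<partial>M) < \<infinity>" using u i le_less_trans by blast
      then show ?thesis
        using luxemburg_level_obtain[of "u i" M n "\<kappa> * V"] u i \<kappa> V by (metis mult_pos_pos)
    qed
    then obtain \<mu> where \<mu>: "\<And>i. i < m \<Longrightarrow> 0 < \<mu> i"
      "\<And>i. i < m \<Longrightarrow> (\<integral>\<^sup>+x. ennreal (Phi n (u i x / \<mu> i)) \<partial>M) \<le> ennreal (\<kappa> * V)"
      "\<And>i. i < m \<Longrightarrow> ennreal (\<kappa> * V) < (\<integral>\<^sup>+x. ennreal (Phi n (u i x / (\<mu> i / 2))) \<partial>M)"
      by metis
    have prod: "1 < (\<Prod>i<m. \<mu> i)"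
    proof (rule ccontr)
      assume "\<not> 1 < (\<Prod>i<m. \<mu> i)"
      then have "ennreal V \<le> ennreal A * (\<Sum>i<m. \<integral>\<^sup>+x. ennreal (Phi n (u i x / \<mu> i)) \<partial>M)"
        using H \<mu>(1) by auto
      also have "\<dots> \<le> ennreal A * (\<Sum>i<m. ennreal (\<kappa> * V))"
        using \<mu>(2) by (intro mult_left_mono sum_mono) auto
      also have "\<dots> = ennreal (A * (real m * (\<kappa> * V)))"
        using A \<kappa> V by (subst sum_ennreal) (auto simp: ennreal_mult')
      also have "A * (real m * (\<kappa> * V)) = V / 2" using A m by (simp add: \<kappa>_def)
      finally show False using V by (simp add: ennreal_le_iff)
    qed
    define W where "W = (\<Prod>i<m. level_weight n m (\<mu> i))"
    have W: "1 \<le> D * W" unfolding D_def W_def using \<mu>(1) prod by (intro prod_level_weight_ge) auto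
    \<comment> \<open>Both \<open>D * W\<close> and the product of the levels are at least 1 and can
      be inserted. Multiplying the m lower bounds produces \<open>c ^ m\<close>, hence the quotient
      in \<open>C\<close>.\<close>
    have "V ^ m * 1 \<le> V ^ m * ((D * W) * (\<Prod>i<m. \<mu> i))"
      using W prod V by (intro mult_left_mono) (simp_all add: mult_ge1_I less_imp_le)
    also have "\<dots> = C * (\<Prod>i<m. c * V * \<mu> i * level_weight n m (\<mu> i))"
      using c by (simp add: C_def W_def prod.distrib field_simps)
    finally have "ennreal (V ^ m) \<le> ennreal (C * (\<Prod>i<m. c * V * \<mu> i * level_weight n m (\<mu> i)))"
      by (simp add: ennreal_leI)
    also have "\<dots> = ennreal C * (\<Prod>i<m. ennreal (c * V * \<mu> i * level_weight n m (\<mu> i)))"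
      using C c V \<mu>(1) level_weight_pos[of n m]
      by (subst prod_ennreal) (auto simp: ennreal_mult' less_imp_le)
    also have "\<dots> \<le> ennreal C * (\<Prod>i<m. \<integral>\<^sup>+x. ennreal ((Phi n ^^ m) (u i x)) \<partial>M)"
    proof (intro mult_left_mono prod_mono_ennreal)
      fix i assume "i \<in> {..<m}"
      then have i: "i < m" by simp
      show "ennreal (c * V * \<mu> i * level_weight n m (\<mu> i)) \<le> (\<integral>\<^sup>+x. ennreal ((Phi n ^^ m) (u i x)) \<partial>M)"
        by (rule ge[OF _ _ V \<mu>(1)[OF i] less_imp_le[OF \<mu>(3)[OF i]]]) (use u i in auto)
    qed simp
    finally show "ennreal (V ^ m) \<le> ennreal C * (\<Prod>i<m. \<integral>\<^sup>+x. ennreal ((Phi n ^^ m) (u i x)) \<partial>M)" .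
  qed
qed

section \<open>Families of rectangles\<close>

lemma multilinear_box_family_weak_type:
  assumes m: "1 \<le> m"
  obtains C :: real where "0 < C"
    "\<And>(f :: nat \<Rightarrow> real ^ 'n \<Rightarrow> real) B. finite B \<Longrightarrow>
      (\<forall>i<m. f i \<in> borel_measurable lebesgue \<and> (\<forall>y. 0 \<le> f i y) \<and>
        (\<integral>\<^sup>+y. ennreal ((Phi CARD('n) ^^ m) (f i y)) \<partial>lebesgue) < \<infinity>) \<Longrightarrow>
      (\<forall>(a, b)\<in>B. (\<forall>k. a $ k < b $ k) \<and>
        ennreal (measure lebesgue (box a b) ^ m) < (\<Prod>i<m. \<integral>\<^sup>+y\<in>box a b. ennreal (f i y) \<partial>lebesgue)) \<Longrightarrow>
      ennreal (measure lebesgue (\<Union>(a, b)\<in>B. box a b) ^ m) \<le>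
        ennreal C * (\<Prod>i<m. \<integral>\<^sup>+y. ennreal ((Phi CARD('n) ^^ m) (f i y)) \<partial>lebesgue)"
proof -
  let ?n = "CARD('n)"
  define A where "A = 12 ^ ?n * (2 * (real ?n + 3) ^ (?n - 1) * 2 ^ (?n - 1))"
  have A: "0 < A" by (simp add: A_def)
  have A_eq: "12 ^ ?n * ennreal (2 * (real ?n + 3) ^ (?n - 1) * 2 ^ (?n - 1)) = ennreal A"
    unfolding A_def by (subst ennreal_mult) (auto simp: ennreal_power[symmetric])
  obtain C where C: "0 < C" and prod: "\<And>(M :: (real ^ 'n) measure) u V.
    (\<forall>i<m. u i \<in> borel_measurable M \<and> (\<forall>x. 0 \<le> u i x) \<and> 0 < (\<integral>\<^sup>+x. ennreal (u i x) \<partial>M) \<and>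
      (\<integral>\<^sup>+x. ennreal ((Phi ?n ^^ m) (u i x)) \<partial>M) < \<infinity>) \<Longrightarrow>
    0 < V \<Longrightarrow> emeasure M (space M) = ennreal V \<Longrightarrow>
    (\<And>\<mu>. (\<forall>i<m. 0 < \<mu> i) \<Longrightarrow> (\<Prod>i<m. \<mu> i) \<le> 1 \<Longrightarrow>
      ennreal V \<le> ennreal A * (\<Sum>i<m. \<integral>\<^sup>+x. ennreal (Phi ?n (u i x / \<mu> i)) \<partial>M)) \<Longrightarrow>
    ennreal (V ^ m) \<le> ennreal C * (\<Prod>i<m. \<integral>\<^sup>+x. ennreal ((Phi ?n ^^ m) (u i x)) \<partial>M)"
    using multilinear_weak_type_product[OF A m, where n = ?n and 'a = "real ^ 'n"] by blast
  show ?thesis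
  proof (rule that[OF C])
    fix f :: "nat \<Rightarrow> real ^ 'n \<Rightarrow> real" and B
    assume B: "finite B" and f: "\<forall>i<m. f i \<in> borel_measurable lebesgue \<and> (\<forall>x. 0 \<le> f i x) \<and>
        (\<integral>\<^sup>+y. ennreal ((Phi ?n ^^ m) (f i y)) \<partial>lebesgue) < \<infinity>"
      and avg: "\<forall>(a, b)\<in>B. (\<forall>k. a $ k < b $ k) \<and>
        ennreal (measure lebesgue (box a b) ^ m) < (\<Prod>i<m. \<integral>\<^sup>+y\<in>box a b. ennreal (f i y) \<partial>lebesgue)"
    define E where "E = (\<Union>(a, b)\<in>B. box a b)"
    define V where "V = measure lebesgue E"
    have E: "E \<in> lmeasurable"
      unfolding E_def using B by (intro fmeasurable.finite_UN) auto
    then have Es [measurable]: "E \<in> sets lebesgue" by (rule fmeasurableD)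
    have eE: "emeasure lebesgue E = ennreal V"
      unfolding V_def using E by (intro emeasure_eq_measure2) auto
    have sub: "box a b \<subseteq> E" if "(a, b) \<in> B" for a b using that by (auto simp: E_def)
    show "ennreal (measure lebesgue (\<Union>(a, b)\<in>B. box a b) ^ m) \<le>
      ennreal C * (\<Prod>i<m. \<integral>\<^sup>+y. ennreal ((Phi ?n ^^ m) (f i y)) \<partial>lebesgue)"
    proof (cases "B = {}")
      case True
      then show ?thesis using m by (cases m) auto
    next
      case False
      then obtain a0 b0 where ab0: "(a0, b0) \<in> B" by auto
      have pos: "a $ k < b $ k" if "(a, b) \<in> B" for a b k using avg that by blast
      have vol: "0 < measure lebesgue (box a b)" if "(a, b) \<in> B" for a b
        using pos[OF that] by (subst measure_lebesgue_box_cart) (auto intro: less_imp_le prod_pos)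
      have "measure lebesgue (box a0 b0) \<le> V"
        unfolding V_def using E sub[OF ab0] by (intro measure_mono_fmeasurable) auto
      then have V: "0 < V" using vol[OF ab0] by linarith
      let ?M = "restrict_space lebesgue E"
      have int: "(\<integral>\<^sup>+x. h x \<partial>?M) = (\<integral>\<^sup>+x\<in>E. h x \<partial>lebesgue)" for h :: "real ^ 'n \<Rightarrow> ennreal"
        by (rule nn_integral_restrict_space) simp
      \<comment> \<open>The strict lower bound on a single box forces every factor to be positive,
        as the existence of a Luxemburg level requires.\<close>
      have int_pos: "0 < (\<integral>\<^sup>+x\<in>E. ennreal (f i x) \<partial>lebesgue)" if "i < m" for i
      proof -
        have "0 < (\<Prod>i<m. \<integral>\<^sup>+y\<in>box a0 b0. ennreal (f i y) \<partial>lebesgue)"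
          using avg ab0 by (metis (mono_tags, lifting) case_prodD le_less_trans zero_le)
        then have "(\<integral>\<^sup>+y\<in>box a0 b0. ennreal (f i y) \<partial>lebesgue) \<noteq> 0"
          using that by (metis (no_types, lifting) ennreal_prod_eq_0 finite_lessThan lessThan_iff less_irrefl)
        moreover have "(\<integral>\<^sup>+y\<in>box a0 b0. ennreal (f i y) \<partial>lebesgue) \<le> (\<integral>\<^sup>+x\<in>E. ennreal (f i x) \<partial>lebesgue)"
          using sub[OF ab0] by (intro nn_integral_mono) (auto simp: indicator_def)
        ultimately show ?thesis by (metis le_zero_eq not_gr_zero)
      qed
      have "ennreal (V ^ m) \<le> ennreal C * (\<Prod>i<m. \<integral>\<^sup>+x. ennreal ((Phi ?n ^^ m) (f i x)) \<partial>?M)"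
      proof (rule prod[OF _ V])
        have "(\<integral>\<^sup>+x\<in>E. h x \<partial>lebesgue) < \<infinity>" if "(\<integral>\<^sup>+x. h x \<partial>lebesgue) < \<infinity>" for h
          using that by (rule le_less_trans[rotated]) (auto intro!: nn_integral_mono simp: indicator_def)
        then show "\<forall>i<m. f i \<in> borel_measurable ?M \<and> (\<forall>x. 0 \<le> f i x) \<and> 0 < (\<integral>\<^sup>+x. ennreal (f i x) \<partial>?M) \<and>
            (\<integral>\<^sup>+x. ennreal ((Phi ?n ^^ m) (f i x)) \<partial>?M) < \<infinity>"
          using f int_pos by (auto simp: int intro: measurable_restrict_space1)
        show "emeasure ?M (space ?M) = ennreal V"
          using eE by (simp add: emeasure_restrict_space space_restrict_space)
        fix \<mu> :: "nat \<Rightarrow> real" assume \<mu>: "\<forall>i<m. 0 < \<mu> i" "(\<Prod>i<m. \<mu> i) \<le> 1"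
        \<comment> \<open>The cut-off changes nothing on the boxes, which all lie in
          \<open>E\<close>, but makes the linear estimate return an integral over \<open>E\<close>
          alone, the one that the restricted measure sees.\<close>
        define g where "g i x = indicator E x * (f i x / \<mu> i)" for i x
        define B' where "B' i = {(a, b) \<in> B. ennreal (measure lebesgue (box a b)) <
          (\<integral>\<^sup>+y\<in>box a b. ennreal (g i y) \<partial>lebesgue)}" for i
        have g: "g i \<in> borel_measurable lebesgue" if "i < m" for i
          unfolding g_def using f that by (intro borel_measurable_times borel_measurable_divide) auto
        \<comment> \<open>If every \<open>f i\<close> had average at most \<open>\<mu> i\<close> on
          a box, the product of the averages would be at most 1, against the choice of the box. So
          the subfamilies \<open>B' i\<close> exhaust \<open>B\<close>.\<close>
        have ex: "\<exists>i<m. (a, b) \<in> B' i" if ab: "(a, b) \<in> B" for a b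
        proof (rule ccontr)
          let ?v = "measure lebesgue (box a b)"
          have box: "(indicator (box a b) :: real ^ 'n \<Rightarrow> ennreal) \<in> borel_measurable lebesgue"
            by (rule borel_measurable_indicator) simp
          assume none: "\<not> (\<exists>i<m. (a, b) \<in> B' i)"
          then have le: "(\<integral>\<^sup>+y\<in>box a b. ennreal (g i y) \<partial>lebesgue) \<le> ennreal ?v" if "i < m" for i
          proof -
            have "(a, b) \<notin> B' i" using none that by blast
            then show ?thesis using ab by (auto simp: B'_def not_less)
          qed
          have "(\<integral>\<^sup>+y\<in>box a b. ennreal (f i y) \<partial>lebesgue) \<le> ennreal (\<mu> i * ?v)" if i: "i < m" for i
          proof -
            have "(\<integral>\<^sup>+y\<in>box a b. ennreal (f i y) \<partial>lebesgue) =
                (\<integral>\<^sup>+y. ennreal (\<mu> i) * (ennreal (g i y) * indicator (box a b) y) \<partial>lebesgue)"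
            proof (intro nn_integral_cong)
              fix y
              show "ennreal (f i y) * indicator (box a b) y =
                  ennreal (\<mu> i) * (ennreal (g i y) * indicator (box a b) y)"
                using \<mu>(1) i sub[OF ab]
                by (auto simp: g_def indicator_def ennreal_mult'[symmetric] less_imp_le)
            qed
            also have "\<dots> = ennreal (\<mu> i) * (\<integral>\<^sup>+y\<in>box a b. ennreal (g i y) \<partial>lebesgue)"
              using g[OF i] box by (intro nn_integral_cmult borel_measurable_times_ennreal measurable_compose[OF _ measurable_ennreal])
            also have "\<dots> \<le> ennreal (\<mu> i) * ennreal ?v" using le[OF i] by (rule mult_left_mono) simp
            finally show ?thesis using \<mu>(1) i by (simp add: ennreal_mult' less_imp_le)
          qed
          then have "(\<Prod>i<m. \<integral>\<^sup>+y\<in>box a b. ennreal (f i y) \<partial>lebesgue) \<le> (\<Prod>i<m. ennreal (\<mu> i * ?v))"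
            by (intro prod_mono_ennreal) auto
          also have "\<dots> = ennreal ((\<Prod>i<m. \<mu> i) * ?v ^ m)"
            using \<mu>(1) by (subst prod_ennreal) (auto simp: prod.distrib less_imp_le)
          also have "\<dots> \<le> ennreal (1 * ?v ^ m)"
            using \<mu>(2) by (intro ennreal_leI mult_right_mono) auto
          finally have "(\<Prod>i<m. \<integral>\<^sup>+y\<in>box a b. ennreal (f i y) \<partial>lebesgue) \<le> ennreal (?v ^ m)" by simp
          moreover have "ennreal (?v ^ m) < (\<Prod>i<m. \<integral>\<^sup>+y\<in>box a b. ennreal (f i y) \<partial>lebesgue)"
            using avg ab by blast
          ultimately show False using leD by blast
        qed
        have finB': "finite (B' i)" for i
          by (rule finite_subset[OF _ B]) (auto simp: B'_def)
        have meas: "(\<Union>(a, b)\<in>B' i. box a b) \<in> sets lebesgue" for i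
          by (intro sets.finite_UN finB') auto
        have bound: "emeasure lebesgue (\<Union>(a, b)\<in>B' i. box a b) \<le>
            ennreal A * (\<integral>\<^sup>+x. ennreal (Phi ?n (f i x / \<mu> i)) \<partial>?M)" if i: "i < m" for i
        proof -
          have "emeasure lebesgue (\<Union>(a, b)\<in>B' i. box a b) \<le>
              ennreal A * (\<integral>\<^sup>+y. ennreal (Phi ?n (g i y)) \<partial>lebesgue)"
            unfolding A_eq[symmetric]
          proof (rule box_family_weak_type[OF g[OF i]])
            show "finite (B' i)" by (rule finB')
          qed (use pos in \<open>auto simp: B'_def\<close>)
          also have "(\<integral>\<^sup>+y. ennreal (Phi ?n (g i y)) \<partial>lebesgue) = (\<integral>\<^sup>+x. ennreal (Phi ?n (f i x / \<mu> i)) \<partial>?M)"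
            unfolding int by (intro nn_integral_cong) (auto simp: g_def indicator_def)
          finally show ?thesis .
        qed
        have "ennreal V \<le> emeasure lebesgue (\<Union>i<m. \<Union>(a, b)\<in>B' i. box a b)"
          unfolding eE[symmetric]
        proof (rule emeasure_mono)
          show "E \<subseteq> (\<Union>i<m. \<Union>(a, b)\<in>B' i. box a b)"
          proof
            fix x assume "x \<in> E"
            then obtain a b where ab: "(a, b) \<in> B" "x \<in> box a b" by (auto simp: E_def)
            then obtain i where "i < m" "(a, b) \<in> B' i" using ex by blast
            then show "x \<in> (\<Union>i<m. \<Union>(a, b)\<in>B' i. box a b)" using ab(2) by blast
          qed
          show "(\<Union>i<m. \<Union>(a, b)\<in>B' i. box a b) \<in> sets lebesgue"
            by (rule sets.finite_UN) (use meas in auto)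
        qed
        also have "\<dots> \<le> (\<Sum>i<m. emeasure lebesgue (\<Union>(a, b)\<in>B' i. box a b))"
          by (rule emeasure_subadditive_finite) (use meas in auto)
        also have "\<dots> \<le> (\<Sum>i<m. ennreal A * (\<integral>\<^sup>+x. ennreal (Phi ?n (f i x / \<mu> i)) \<partial>?M))"
          by (intro sum_mono bound) auto
        finally show "ennreal V \<le> ennreal A * (\<Sum>i<m. \<integral>\<^sup>+x. ennreal (Phi ?n (f i x / \<mu> i)) \<partial>?M)"
          by (simp add: sum_distrib_left)
      qed
      also have "\<dots> \<le> ennreal C * (\<Prod>i<m. \<integral>\<^sup>+y. ennreal ((Phi ?n ^^ m) (f i y)) \<partial>lebesgue)"
        unfolding int
        by (intro mult_left_mono prod_mono_ennreal nn_integral_mono) (auto simp: indicator_def)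
      finally show ?thesis by (simp add: V_def E_def)
    qed
  qed
qed

section \<open>Absorbing the logarithm of the measure\<close>

lemma ln_one_plus_power_le:
  fixes x :: real
  assumes "0 \<le> x"
  shows "ln (1 + x ^ p) \<le> 1 + real p * ln (1 + x)"
proof -
  have "1 + x ^ p \<le> (1 + x) ^ p + (1 + x) ^ p"
    using assms by (intro add_mono one_le_power power_mono) auto
  then have "ln (1 + x ^ p) \<le> ln (2 * (1 + x) ^ p)"
    using assms by (subst ln_le_cancel_iff) (auto intro: add_pos_nonneg)
  also have "\<dots> = ln 2 + real p * ln (1 + x)"
    using assms by (simp add: ln_mult ln_realpow)
  also have "ln 2 \<le> (1::real)" using ln_2_less_1 by simp
  finally show ?thesis by simp
qed

lemma log_plus_eq_ln: "1 \<le> t \<Longrightarrow> log_plus t = ln t"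
  by (simp add: log_plus_def)

lemma log_plus_Phi_le:
  assumes "0 \<le> t"
  shows "log_plus (Phi n t) \<le> (real (n - 1) + 1) * (1 + log_plus t)"
proof -
  let ?l = "log_plus t"
  have "log_plus (Phi n t) \<le> ?l + log_plus (log_factor n t)"
    unfolding Phi_eq using assms by (intro log_plus_mult) auto
  also have "log_plus (log_factor n t) = ln (1 + ?l ^ (n - 1))"
    unfolding log_plus_eq_ln[OF log_factor_ge_1] by (simp add: log_factor_def)
  also have "\<dots> \<le> 1 + real (n - 1) * ln (1 + ?l)" by (rule ln_one_plus_power_le) simp
  also have "\<dots> \<le> 1 + real (n - 1) * ?l"
    by (intro add_left_mono mult_left_mono ln_add_one_self_le_self) auto
  finally show ?thesis by (simp add: algebra_simps)
qed

lemma log_plus_Phi_iter_le: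
  "\<exists>a\<ge>0. \<forall>t\<ge>0. log_plus ((Phi n ^^ k) t) \<le> a * (1 + log_plus t)"
proof (induction k)
  case 0
  show ?case by (auto intro!: exI[of _ 1])
next
  case (Suc k)
  then obtain a where a: "0 \<le> a" "\<And>t. 0 \<le> t \<Longrightarrow> log_plus ((Phi n ^^ k) t) \<le> a * (1 + log_plus t)"
    by blast
  show ?case
  proof (intro exI conjI allI impI)
    let ?b = "(real (n - 1) + 1) * (1 + a)"
    show "0 \<le> ?b" using a(1) by simp
    fix t :: real assume t: "0 \<le> t"
    have "log_plus ((Phi n ^^ Suc k) t) \<le> (real (n - 1) + 1) * (1 + log_plus ((Phi n ^^ k) t))"
      using log_plus_Phi_le[OF Phi_iter_nonneg[OF t]] by simp
    also have "\<dots> \<le> (real (n - 1) + 1) * (1 + a * (1 + log_plus t))"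
      using a(2)[OF t] by (intro mult_left_mono) auto
    also have "\<dots> \<le> (real (n - 1) + 1) * ((1 + a) * (1 + log_plus t))"
      by (intro mult_left_mono) (auto simp: algebra_simps)
    finally show "log_plus ((Phi n ^^ Suc k) t) \<le> ?b * (1 + log_plus t)" by (simp add: mult.assoc)
  qed
qed

lemma log_factor_le_of_log_plus_le:
  assumes "log_plus u \<le> a * (1 + log_plus t)" "0 \<le> a"
  shows "log_factor n u \<le> (1 + (2 * a) ^ (n - 1)) * log_factor n t"
proof -
  let ?p = "n - 1" and ?l = "log_plus t"
  have "log_plus u ^ ?p \<le> (a * (1 + ?l)) ^ ?p" using assms by (intro power_mono) auto
  also have "\<dots> = a ^ ?p * (1 + ?l) ^ ?p" by (simp add: power_mult_distrib)
  also have "\<dots> \<le> a ^ ?p * (2 ^ ?p * (1 ^ ?p + ?l ^ ?p))"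
    using assms by (intro mult_left_mono add_power_le) auto
  also have "\<dots> = (2 * a) ^ ?p * log_factor n t"
    by (simp add: power_mult_distrib log_factor_def)
  finally have "log_factor n u \<le> 1 + (2 * a) ^ ?p * log_factor n t" by (simp add: log_factor_def)
  also have "\<dots> \<le> log_factor n t + (2 * a) ^ ?p * log_factor n t" by simp
  finally show ?thesis by (simp add: distrib_right)
qed

text \<open>The logarithm of an iterate is at most a constant times \<open>1 + log_plus t\<close>,
  so every further application of \<open>Phi n\<close> contributes at most a constant multiple of
  \<open>log_factor n t\<close>.\<close>

lemma Phi_iter_le:
  "\<exists>C>0. \<forall>t\<ge>0. (Phi n ^^ k) t \<le> C * t * log_factor n t ^ k"
proof (induction k)
  case 0
  show ?case by (auto intro!: exI[of _ 1])
next
  case (Suc k)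
  then obtain C where C: "0 < C" "\<And>t. 0 \<le> t \<Longrightarrow> (Phi n ^^ k) t \<le> C * t * log_factor n t ^ k"
    by blast
  obtain a where a: "0 \<le> a" "\<And>t. 0 \<le> t \<Longrightarrow> log_plus ((Phi n ^^ k) t) \<le> a * (1 + log_plus t)"
    using log_plus_Phi_iter_le by blast
  let ?b = "1 + (2 * a) ^ (n - 1)"
  have b: "0 < ?b" using a(1) by (intro add_pos_nonneg) auto
  show ?case
  proof (intro exI conjI allI impI)
    show "0 < C * ?b" using C(1) b by (rule mult_pos_pos)
    fix t :: real assume t: "0 \<le> t"
    have "(Phi n ^^ Suc k) t = (Phi n ^^ k) t * log_factor n ((Phi n ^^ k) t)"
      using Phi_eq[of n "(Phi n ^^ k) t"] by simp
    also have "\<dots> \<le> (C * t * log_factor n t ^ k) * (?b * log_factor n t)"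
      using C t a by (intro mult_mono log_factor_le_of_log_plus_le) auto
    finally show "(Phi n ^^ Suc k) t \<le> C * ?b * t * log_factor n t ^ Suc k" by (simp add: mult_ac)
  qed
qed

text \<open>The hypothesis bounds \<open>ln V\<close> by a multiple of \<open>1 + log_plus X\<close>, because the logarithmic factor
  is dominated by an arbitrarily small power of \<open>V\<close>.\<close>

lemma absorb_log_factor:
  fixes \<gamma> \<beta> C :: real
  assumes \<gamma>: "0 < \<gamma>" and \<beta>: "0 \<le> \<beta>" "\<beta> \<le> 1" and C: "0 < C"
  obtains D :: real where "0 < D"
    "\<And>V X. 0 < V \<Longrightarrow> 0 \<le> X \<Longrightarrow> V powr \<gamma> \<le> C * log_factor n (V powr \<beta>) ^ q * X \<Longrightarrow>
      V powr \<gamma> \<le> D * (1 + (\<beta> * log_plus X) ^ (n - 1)) ^ q * X"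
proof -
  let ?p = "n - 1"
  define w where "w = real q * real ?p + 1"
  have w: "0 < w" by (simp add: w_def add_nonneg_pos)
  \<comment> \<open>Chosen so that the logarithmic factor contributes at most \<gamma> / 2 times ln
    V on the logarithmic scale; half of \<gamma> ln V then survives on the left. The summand 1 in
    \<open>w\<close> prevents a division by 0.\<close>
  define \<delta> where "\<delta> = \<gamma> / (2 * w)"
  have \<delta>: "0 < \<delta>" using \<gamma> w by (simp add: \<delta>_def)
  have "real q * real ?p * \<delta> \<le> w * \<delta>" using \<delta> by (intro mult_right_mono) (auto simp: w_def)
  also have "\<dots> = \<gamma> / 2" using w by (simp add: \<delta>_def)
  finally have q\<delta>: "real q * real ?p * \<delta> \<le> \<gamma> / 2" .
  define e where "e = \<bar>ln C\<bar> + real q + real q * real ?p * (\<delta> + \<bar>ln \<delta>\<bar>)"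
  have e: "0 \<le> e" using \<delta> by (simp add: e_def)
  define a where "a = 2 * (e + 1) / \<gamma>"
  have a: "0 \<le> a" using e \<gamma> by (simp add: a_def)
  define D where "D = C * (2 + (2 * a) ^ ?p) ^ q"
  have D: "0 < D" using C a by (auto simp: D_def intro!: mult_pos_pos zero_less_power add_pos_nonneg)
  show ?thesis
  proof (rule that[OF D])
    fix V X :: real
    assume V: "0 < V" and X: "0 \<le> X" and le: "V powr \<gamma> \<le> C * log_factor n (V powr \<beta>) ^ q * X"
    let ?z = "\<beta> * log_plus X"
    have z: "0 \<le> ?z" using \<beta> by simp
    have "X \<noteq> 0" using le V by auto
    then have X: "0 < X" using X by simp
    have "log_factor n (V powr \<beta>) \<le> (2 + (2 * a) ^ ?p) * (1 + ?z ^ ?p)"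
    proof (cases "V \<le> 1")
      case True
      then have "V powr \<beta> \<le> 1" using \<beta> V by (simp add: powr_le1)
      then have "log_plus (V powr \<beta>) \<le> log_plus 1" by (rule log_plus_mono)
      then have "log_plus (V powr \<beta>) = 0" by (intro antisym) (auto simp: log_plus_eq_ln)
      then have "log_factor n (V powr \<beta>) \<le> 2" by (simp add: log_factor_def power_0_left)
      also have "\<dots> \<le> (2 + (2 * a) ^ ?p) * 1" using a by simp
      also have "\<dots> \<le> (2 + (2 * a) ^ ?p) * (1 + ?z ^ ?p)" using a z by (intro mult_left_mono) auto
      finally show ?thesis .
    next
      case False
      define y where "y = ln V"
      have y: "0 < y" using False by (simp add: y_def)
      have "1 \<le> V powr \<beta>" using False \<beta> by (simp add: ge_one_powr_ge_zero)
      then have lp: "log_plus (V powr \<beta>) = \<beta> * y"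
        using V \<beta> y by (simp add: log_plus_def y_def ln_powr)
      have "ln (log_factor n (V powr \<beta>)) \<le> 1 + real ?p * ln (1 + \<beta> * y)"
        unfolding log_factor_def lp using \<beta> y by (intro ln_one_plus_power_le) auto
      also have "\<dots> \<le> 1 + real ?p * (\<delta> * y + (\<delta> + \<bar>ln \<delta>\<bar>))"
      proof (intro add_left_mono mult_left_mono)
        have "\<beta> * y \<le> 1 * y" using \<beta> y by (intro mult_right_mono) auto
        moreover have "0 \<le> \<beta> * y" using \<beta> y by simp
        ultimately have "ln (1 + \<beta> * y) \<le> ln (1 + y)" by (intro ln_mono) auto
        \<comment> \<open>The bound ln t \<le> t at t = \<delta> (1 + y) gives the logarithm an
          arbitrarily small slope in y.\<close>
        also have "\<dots> = ln (\<delta> * (1 + y)) - ln \<delta>" using \<delta> y by (simp add: ln_mult)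
        also have "ln (\<delta> * (1 + y)) \<le> \<delta> * (1 + y)" using \<delta> y by (intro ln_bound) auto
        finally show "ln (1 + \<beta> * y) \<le> \<delta> * y + (\<delta> + \<bar>ln \<delta>\<bar>)" by (simp add: algebra_simps)
      qed simp
      finally have lnL: "ln (log_factor n (V powr \<beta>)) \<le> 1 + real ?p * (\<delta> * y + (\<delta> + \<bar>ln \<delta>\<bar>))" .
      have "\<gamma> * y = ln (V powr \<gamma>)" using V by (simp add: y_def ln_powr)
      also have "\<dots> \<le> ln (C * log_factor n (V powr \<beta>) ^ q * X)"
        using le V C X by (intro ln_mono) auto
      also have "\<dots> = ln C + real q * ln (log_factor n (V powr \<beta>)) + ln X"
        using C X less_imp_neq[OF log_factor_pos[of n "V powr \<beta>"]] by (simp add: ln_mult ln_realpow)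
      also have "\<dots> \<le> \<bar>ln C\<bar> + real q * (1 + real ?p * (\<delta> * y + (\<delta> + \<bar>ln \<delta>\<bar>))) + log_plus X"
        using lnL X by (intro add_mono mult_left_mono ln_le_log_plus) auto
      also have "\<dots> = e + (real q * real ?p * \<delta>) * y + log_plus X"
        by (simp add: e_def algebra_simps)
      also have "\<dots> \<le> e + \<gamma> / 2 * y + log_plus X"
        using q\<delta> y by (intro add_mono mult_right_mono) auto
      finally have "\<gamma> * y \<le> 2 * (e + log_plus X)" by simp
      also have "\<dots> \<le> 2 * ((e + 1) * (1 + log_plus X))"
        using e by (simp add: algebra_simps)
      finally have "y \<le> a * (1 + log_plus X)" using \<gamma> by (simp add: a_def field_simps)
      \<comment> \<open>The factor \<beta> has to be kept in front of \<open>log_plus X\<close>: for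
        \<beta> = 0 the bound must not depend on that logarithm.\<close>
      then have "\<beta> * y \<le> \<beta> * (a * (1 + log_plus X))" using \<beta> by (intro mult_left_mono)
      also have "\<dots> = a * (\<beta> + ?z)" by (simp add: algebra_simps)
      also have "\<dots> \<le> a * (1 + ?z)" using a \<beta> by (intro mult_left_mono) auto
      finally have "(\<beta> * y) ^ ?p \<le> (a * (1 + ?z)) ^ ?p" using \<beta> y by (intro power_mono) auto
      also have "\<dots> = a ^ ?p * (1 + ?z) ^ ?p" by (rule power_mult_distrib)
      also have "\<dots> \<le> a ^ ?p * (2 ^ ?p * (1 ^ ?p + ?z ^ ?p))"
        using a z by (intro mult_left_mono add_power_le) auto
      also have "\<dots> = (2 * a) ^ ?p * (1 + ?z ^ ?p)" by (simp add: power_mult_distrib)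
      finally have "log_factor n (V powr \<beta>) \<le> 1 + (2 * a) ^ ?p * (1 + ?z ^ ?p)"
        by (simp add: log_factor_def lp)
      also have "\<dots> \<le> 2 * (1 + ?z ^ ?p) + (2 * a) ^ ?p * (1 + ?z ^ ?p)" using z by simp
      finally show ?thesis by (simp add: distrib_right)
    qed
    then have "log_factor n (V powr \<beta>) ^ q \<le> ((2 + (2 * a) ^ ?p) * (1 + ?z ^ ?p)) ^ q"
      by (intro power_mono) auto
    then have "C * log_factor n (V powr \<beta>) ^ q * X \<le> C * ((2 + (2 * a) ^ ?p) * (1 + ?z ^ ?p)) ^ q * X"
      using C X by (intro mult_right_mono mult_left_mono) auto
    with le show "V powr \<gamma> \<le> D * (1 + ?z ^ ?p) ^ q * X"
      by (simp add: D_def power_mult_distrib mult.assoc)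
  qed
qed

text \<open>Scaling by v = \<open>V powr \<beta>\<close> costs at most a constant times
  \<open>v * log_factor n v ^ m\<close> in each of the m factors. Cancelling \<open>v ^ m\<close>
  lowers the power of V from m to m (1 - \<beta>), and \<open>m * m\<close> logarithmic factors
  remain, which \<open>absorb_log_factor\<close> expresses through the integrals.\<close>

lemma fractional_box_family_weak_type:
  fixes \<beta> :: real
  assumes m: "1 \<le> m" and \<beta>: "0 \<le> \<beta>" "\<beta> < 1"
  obtains C :: real where "0 < C"
    "\<And>(f :: nat \<Rightarrow> real ^ 'n \<Rightarrow> real) B X. finite B \<Longrightarrow>
      (\<forall>i<m. f i \<in> borel_measurable lebesgue \<and> (\<forall>y. 0 \<le> f i y) \<and> 0 \<le> X i \<and>
        (\<integral>\<^sup>+y. ennreal ((Phi CARD('n) ^^ m) (f i y)) \<partial>lebesgue) = ennreal (X i)) \<Longrightarrow>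
      (\<forall>(a, b)\<in>B. (\<forall>k. a $ k < b $ k) \<and>
        ennreal ((measure lebesgue (box a b) powr (1 - \<beta>)) ^ m) <
          (\<Prod>i<m. \<integral>\<^sup>+y\<in>box a b. ennreal (f i y) \<partial>lebesgue)) \<Longrightarrow>
      measure lebesgue (\<Union>(a, b)\<in>B. box a b) powr (real m * (1 - \<beta>)) \<le>
        C * (1 + (\<beta> * log_plus (\<Prod>i<m. X i)) ^ (CARD('n) - 1)) ^ (m * m) * (\<Prod>i<m. X i)"
proof -
  let ?n = "CARD('n)"
  obtain C1 where C1: "0 < C1" and weak: "\<And>(f :: nat \<Rightarrow> real ^ 'n \<Rightarrow> real) B. finite B \<Longrightarrow>
    (\<forall>i<m. f i \<in> borel_measurable lebesgue \<and> (\<forall>y. 0 \<le> f i y) \<and>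
      (\<integral>\<^sup>+y. ennreal ((Phi ?n ^^ m) (f i y)) \<partial>lebesgue) < \<infinity>) \<Longrightarrow>
    (\<forall>(a, b)\<in>B. (\<forall>k. a $ k < b $ k) \<and>
      ennreal (measure lebesgue (box a b) ^ m) < (\<Prod>i<m. \<integral>\<^sup>+y\<in>box a b. ennreal (f i y) \<partial>lebesgue)) \<Longrightarrow>
    ennreal (measure lebesgue (\<Union>(a, b)\<in>B. box a b) ^ m) \<le>
      ennreal C1 * (\<Prod>i<m. \<integral>\<^sup>+y. ennreal ((Phi ?n ^^ m) (f i y)) \<partial>lebesgue)"
    using that by (rule multilinear_box_family_weak_type[OF m, where 'n = 'n])
  obtain C2 where C2: "0 < C2" and mult: "\<forall>a\<ge>0. \<forall>b\<ge>0.
      (Phi ?n ^^ m) (a * b) \<le> C2 * (Phi ?n ^^ m) a * (Phi ?n ^^ m) b"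
    using Phi_iter_mult[where n = ?n and m = m] by (elim exE conjE) (rule that)
  obtain C3 where C3: "0 < C3" and growth: "\<forall>t\<ge>0. (Phi ?n ^^ m) t \<le> C3 * t * log_factor ?n t ^ m"
    using Phi_iter_le[where n = ?n and k = m] by (elim exE conjE) (rule that)
  define \<gamma> where "\<gamma> = real m * (1 - \<beta>)"
  have \<gamma>: "0 < \<gamma>" using m \<beta> by (simp add: \<gamma>_def)
  define C4 where "C4 = C1 * (C2 * C3) ^ m"
  have C4: "0 < C4" using C1 C2 C3 by (simp add: C4_def)
  obtain D where D: "0 < D" and absorb: "\<And>V X. 0 < V \<Longrightarrow> 0 \<le> X \<Longrightarrow>
      V powr \<gamma> \<le> C4 * log_factor ?n (V powr \<beta>) ^ (m * m) * X \<Longrightarrow>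
      V powr \<gamma> \<le> D * (1 + (\<beta> * log_plus X) ^ (?n - 1)) ^ (m * m) * X"
    using that by (rule absorb_log_factor[OF \<gamma> \<beta>(1) less_imp_le[OF \<beta>(2)] C4])
  show ?thesis
  proof (rule that[OF D])
    fix f :: "nat \<Rightarrow> real ^ 'n \<Rightarrow> real" and B and X :: "nat \<Rightarrow> real"
    assume B: "finite B" and f: "\<forall>i<m. f i \<in> borel_measurable lebesgue \<and> (\<forall>y. 0 \<le> f i y) \<and> 0 \<le> X i \<and>
        (\<integral>\<^sup>+y. ennreal ((Phi ?n ^^ m) (f i y)) \<partial>lebesgue) = ennreal (X i)"
      and avg: "\<forall>(a, b)\<in>B. (\<forall>k. a $ k < b $ k) \<and>
        ennreal ((measure lebesgue (box a b) powr (1 - \<beta>)) ^ m) <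
          (\<Prod>i<m. \<integral>\<^sup>+y\<in>box a b. ennreal (f i y) \<partial>lebesgue)"
    define E where "E = (\<Union>(a, b)\<in>B. box a b)"
    define V where "V = measure lebesgue E"
    have X: "0 \<le> (\<Prod>i<m. X i)" using f by (intro prod_nonneg) auto
    have E: "E \<in> lmeasurable"
      unfolding E_def using B by (intro fmeasurable.finite_UN) auto
    have "V powr \<gamma> \<le> D * (1 + (\<beta> * log_plus (\<Prod>i<m. X i)) ^ (?n - 1)) ^ (m * m) * (\<Prod>i<m. X i)"
    proof (cases "V = 0")
      case True
      then show ?thesis using D X \<beta> by simp
    next
      case False
      then have V: "0 < V" by (simp add: V_def zero_less_measure_iff)
      define v where "v = V powr \<beta>"
      have v: "0 < v" using V by (simp add: v_def)
      have "(Phi ?n ^^ m) v \<ge> 0" using v by (simp add: Phi_iter_nonneg)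
      then have c: "0 \<le> C2 * (Phi ?n ^^ m) v" using C2 by simp
      have int_le: "(\<integral>\<^sup>+y. ennreal ((Phi ?n ^^ m) (v * f i y)) \<partial>lebesgue) \<le>
          ennreal (C2 * (Phi ?n ^^ m) v * X i)" if i: "i < m" for i
      proof -
        have [measurable]: "f i \<in> borel_measurable lebesgue" using f i by blast
        have "(\<integral>\<^sup>+y. ennreal ((Phi ?n ^^ m) (v * f i y)) \<partial>lebesgue) \<le>
            (\<integral>\<^sup>+y. ennreal (C2 * (Phi ?n ^^ m) v) * ennreal ((Phi ?n ^^ m) (f i y)) \<partial>lebesgue)"
        proof (intro nn_integral_mono)
          fix y
          have "0 \<le> f i y" using f i by blast
          then show "ennreal ((Phi ?n ^^ m) (v * f i y)) \<le>
              ennreal (C2 * (Phi ?n ^^ m) v) * ennreal ((Phi ?n ^^ m) (f i y))"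
            using mult[rule_format, of v "f i y"] v c by (simp add: ennreal_mult'[symmetric] ennreal_leI)
        qed
        also have "\<dots> = ennreal (C2 * (Phi ?n ^^ m) v) * ennreal (X i)"
          using f i by (subst nn_integral_cmult) auto
        finally show ?thesis using c by (simp add: ennreal_mult')
      qed
      have "ennreal (V ^ m) \<le> ennreal C1 * (\<Prod>i<m. \<integral>\<^sup>+y. ennreal ((Phi ?n ^^ m) (v * f i y)) \<partial>lebesgue)"
        unfolding V_def E_def
      proof (rule weak[OF B])
        have "(\<integral>\<^sup>+y. ennreal ((Phi ?n ^^ m) (v * f i y)) \<partial>lebesgue) < \<infinity>" if "i < m" for i
          using int_le[OF that] by (rule le_less_trans) simp
        then show "\<forall>i<m. (\<lambda>y. v * f i y) \<in> borel_measurable lebesgue \<and> (\<forall>y. 0 \<le> v * f i y) \<and>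
            (\<integral>\<^sup>+y. ennreal ((Phi ?n ^^ m) (v * f i y)) \<partial>lebesgue) < \<infinity>"
          using f v by (auto intro!: borel_measurable_times)
        show "\<forall>(a, b)\<in>B. (\<forall>k. a $ k < b $ k) \<and> ennreal (measure lebesgue (box a b) ^ m) <
            (\<Prod>i<m. \<integral>\<^sup>+y\<in>box a b. ennreal (v * f i y) \<partial>lebesgue)"
        proof (clarify, intro conjI)
          fix a b assume ab: "(a, b) \<in> B"
          show "\<forall>k. a $ k < b $ k" using avg ab by blast
          define r where "r = measure lebesgue (box a b)"
          have "r \<le> V"
            unfolding r_def V_def by (rule measure_mono_fmeasurable) (use E ab in \<open>auto simp: E_def\<close>)
          moreover have "0 \<le> r" by (simp add: r_def)
          ultimately have r: "0 \<le> r" "r \<le> V" by simp_all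
          have box: "(indicator (box a b) :: real ^ 'n \<Rightarrow> ennreal) \<in> borel_measurable lebesgue"
            by (rule borel_measurable_indicator) simp
          have "r = r powr (1 - \<beta>) * r powr \<beta>" using r by (simp add: powr_add[symmetric])
          then have "r ^ m = (r powr \<beta>) ^ m * (r powr (1 - \<beta>)) ^ m"
            by (metis mult.commute power_mult_distrib)
          also have "\<dots> \<le> v ^ m * (r powr (1 - \<beta>)) ^ m"
            unfolding v_def using r \<beta> by (intro mult_right_mono power_mono powr_mono2) auto
          finally have "ennreal (r ^ m) \<le> ennreal (v ^ m) * ennreal ((r powr (1 - \<beta>)) ^ m)"
            using v by (simp add: ennreal_mult'[symmetric] ennreal_leI)
          also have "\<dots> < ennreal (v ^ m) * (\<Prod>i<m. \<integral>\<^sup>+y\<in>box a b. ennreal (f i y) \<partial>lebesgue)"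
            using avg ab v by (intro ennreal_mult_strict_left_mono) (auto simp: r_def)
          also have "\<dots> = (\<Prod>i<m. ennreal v * (\<integral>\<^sup>+y\<in>box a b. ennreal (f i y) \<partial>lebesgue))"
            using v by (simp add: prod.distrib ennreal_power)
          also have "\<dots> = (\<Prod>i<m. \<integral>\<^sup>+y\<in>box a b. ennreal (v * f i y) \<partial>lebesgue)"
          proof (intro prod.cong refl)
            fix i assume "i \<in> {..<m}"
            then have "f i \<in> borel_measurable lebesgue" using f by blast
            then have "ennreal v * (\<integral>\<^sup>+y\<in>box a b. ennreal (f i y) \<partial>lebesgue) =
                (\<integral>\<^sup>+y. ennreal v * (ennreal (f i y) * indicator (box a b) y) \<partial>lebesgue)"
              using box by (intro nn_integral_cmult[symmetric] borel_measurable_times_ennreal measurable_compose[OF _ measurable_ennreal])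
            then show "ennreal v * (\<integral>\<^sup>+y\<in>box a b. ennreal (f i y) \<partial>lebesgue) =
                (\<integral>\<^sup>+y\<in>box a b. ennreal (v * f i y) \<partial>lebesgue)"
              using v by (simp add: ennreal_mult' mult.assoc)
          qed
          finally show "ennreal (measure lebesgue (box a b) ^ m) <
            (\<Prod>i<m. \<integral>\<^sup>+y\<in>box a b. ennreal (v * f i y) \<partial>lebesgue)" by (simp add: r_def)
        qed
      qed
      also have "\<dots> \<le> ennreal C1 * (\<Prod>i<m. ennreal (C2 * (Phi ?n ^^ m) v * X i))"
        by (intro mult_left_mono prod_mono_ennreal int_le) auto
      also have "\<dots> = ennreal (C1 * (\<Prod>i<m. C2 * (Phi ?n ^^ m) v * X i))"
        using C1 c f by (subst prod_ennreal) (auto simp: ennreal_mult')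
      also have "(\<Prod>i<m. C2 * (Phi ?n ^^ m) v * X i) = (C2 * (Phi ?n ^^ m) v) ^ m * (\<Prod>i<m. X i)"
        by (simp add: prod.distrib)
      finally have "V ^ m \<le> C1 * ((C2 * (Phi ?n ^^ m) v) ^ m * (\<Prod>i<m. X i))"
        using C1 X c by (subst (asm) ennreal_le_iff) auto
      also have "\<dots> \<le> C1 * ((C2 * (C3 * v * log_factor ?n v ^ m)) ^ m * (\<Prod>i<m. X i))"
        using C1 C2 X c v by (intro mult_left_mono mult_right_mono power_mono growth[rule_format]) auto
      also have "\<dots> = v ^ m * (C4 * log_factor ?n v ^ (m * m) * (\<Prod>i<m. X i))"
        by (simp add: C4_def power_mult_distrib power_mult mult_ac)
      finally have "V ^ m \<le> v ^ m * (C4 * log_factor ?n v ^ (m * m) * (\<Prod>i<m. X i))" .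
      moreover have "V ^ m = v ^ m * V powr \<gamma>"
      proof -
        have "V ^ m = V powr (\<beta> * real m + \<gamma>)" using V by (simp add: \<gamma>_def powr_realpow[symmetric] algebra_simps)
        also have "\<dots> = v ^ m * V powr \<gamma>"
          using V by (simp add: powr_add v_def powr_powr[symmetric] powr_realpow)
        finally show ?thesis .
      qed
      ultimately have "V powr \<gamma> \<le> C4 * log_factor ?n v ^ (m * m) * (\<Prod>i<m. X i)"
        using v by simp
      then show ?thesis using absorb[OF V X] by (simp add: v_def)
    qed
    then show "measure lebesgue (\<Union>(a, b)\<in>B. box a b) powr (real m * (1 - \<beta>)) \<le>
      D * (1 + (\<beta> * log_plus (\<Prod>i<m. X i)) ^ (?n - 1)) ^ (m * m) * (\<Prod>i<m. X i)"
      by (simp add: V_def E_def \<gamma>_def)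
  qed
qed

lemma locally_integrable_measurable:
  fixes f :: "real ^ 'n \<Rightarrow> complex"
  assumes "locally_integrable f"
  shows "f \<in> borel_measurable lebesgue"
proof (rule borel_measurable_LIMSEQ_metric)
  fix N :: nat
  have "f absolutely_integrable_on cball 0 (real N)"
    using assms by (simp add: locally_integrable_def)
  then show "(\<lambda>x. indicator (cball 0 (real N)) x *\<^sub>R f x) \<in> borel_measurable lebesgue"
    unfolding set_integrable_def by (rule borel_measurable_integrable)
next
  fix x :: "real ^ 'n"
  obtain N0 :: nat where N0: "norm x \<le> real N0" using real_arch_simple by blast
  have "indicator (cball 0 (real N)) x *\<^sub>R f x = f x" if "N0 \<le> N" for N :: nat
  proof -
    have "norm x \<le> real N" using N0 that by linarith
    then show ?thesis by (simp add: indicator_def)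
  qed
  then show "(\<lambda>N. indicator (cball 0 (real N)) x *\<^sub>R f x) \<longlonglongrightarrow> f x"
    by (intro tendsto_eventually eventually_sequentiallyI[of N0])
qed

section \<open>Level sets of the maximal function\<close>

text \<open>Rectangles are open, so by Lindelof countably many of them have the same union, and
  continuity from below reduces that union to finite ones. The bound has to be the same for all
  finite families.\<close>

lemma rectangle_family_exhaustion:
  fixes P :: "(real ^ 'n) set \<Rightarrow> bool" and c :: real
  assumes bound: "\<And>B. finite B \<Longrightarrow> (\<And>a b. (a, b) \<in> B \<Longrightarrow> (\<forall>k. a $ k < b $ k) \<and> P (box a b)) \<Longrightarrow>
    emeasure lebesgue (\<Union>(a, b)\<in>B. box a b) \<le> c"
  shows "emeasure lebesgue (\<Union>{R \<in> rectangles. P R}) \<le> c"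
proof -
  have op: "open R" if "R \<in> {R \<in> rectangles. P R}" for R
    using that by (auto simp: rectangles_def open_box)
  obtain F where F: "F \<subseteq> {R \<in> rectangles. P R}" "countable F" "\<Union>F = \<Union>{R \<in> rectangles. P R}"
  proof (rule Lindelof[of "{R \<in> rectangles. P R}"])
    show "open R" if "R \<in> {R \<in> rectangles. P R}" for R using that by (rule op)
  qed (rule that)
  show ?thesis
  proof (cases "F = {}")
    case True
    then show ?thesis unfolding F(3)[symmetric] by simp
  next
    case False
    define R where "R = from_nat_into F"
    have R: "range R = F" using False F(2) by (simp add: R_def range_from_nat_into)
    have "\<exists>ab. R i = box (fst ab) (snd ab) \<and> (\<forall>k. fst ab $ k < snd ab $ k) \<and> P (R i)" for i
    proof -
      have "R i \<in> rectangles" "P (R i)" using F(1) R by blast+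
      then show ?thesis unfolding rectangles_def by auto
    qed
    then obtain h where h: "\<And>i. R i = box (fst (h i)) (snd (h i)) \<and> (\<forall>k. fst (h i) $ k < snd (h i) $ k) \<and> P (R i)"
      by metis
    have Rbox: "R i = box (fst (h i)) (snd (h i))" for i using h by blast
    define E where "E N = (\<Union>i<N. R i)" for N :: nat
    have meas: "range E \<subseteq> sets lebesgue" by (auto simp: E_def Rbox intro!: sets.finite_UN)
    have inc: "incseq E" by (auto simp: incseq_def E_def intro: less_le_trans)
    have "(\<Union>N. E N) = \<Union>F" unfolding R[symmetric] by (auto simp: E_def)
    then have "emeasure lebesgue (\<Union>{R \<in> rectangles. P R}) = (SUP N. emeasure lebesgue (E N))"
      using SUP_emeasure_incseq[OF meas inc] F(3) by simp
    also have "\<dots> \<le> c"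
    proof (rule SUP_least)
      fix N
      have "E N = (\<Union>(a, b)\<in>h ` {..<N}. box a b)" by (simp add: E_def Rbox case_prod_beta)
      moreover have "(\<forall>k. a $ k < b $ k) \<and> P (box a b)" if "(a, b) \<in> h ` {..<N}" for a b
        using that h by (metis fst_conv imageE snd_conv)
      ultimately show "emeasure lebesgue (E N) \<le> c" using bound[of "h ` {..<N}"] by simp
    qed
    finally show ?thesis .
  qed
qed

theorem theorem2p1:
  fixes m :: nat and \<alpha> :: real
  assumes "m \<ge> 1" and "0 \<le> \<alpha>" and "\<alpha> < real m * real CARD('n::finite)"
  shows "\<exists>C::real. C > 0 \<and>
    (\<forall>(f :: nat \<Rightarrow> real ^ 'n \<Rightarrow> complex) (s::real).
      (\<forall>i<m. locally_integrable (f i)) \<longrightarrow> s > 0 \<longrightarrow>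
      epowr (emeasure lebesgue {x. frac_strong_maximal m \<alpha> f x > ennreal (s ^ m)})
          (real m - \<alpha> / real CARD('n))
        \<le> ennreal C *
          (\<Prod>i<m.
            (1 + (ennreal (\<alpha> / (real m * real CARD('n))) *
                   elog_plus (\<Prod>j<m. Phi_integral m s (f j))) ^ (CARD('n) - 1)) ^ m
            * Phi_integral m s (f i)))"
proof -
  let ?n = "CARD('n)"
  define \<beta> where "\<beta> = \<alpha> / (real m * real ?n)"
  have \<beta>: "0 \<le> \<beta>" "\<beta> < 1" using assms by (simp_all add: \<beta>_def divide_less_eq)
  define p where "p = real m * (1 - \<beta>)"
  have p: "0 < p" using assms(1) \<beta> by (simp add: p_def)
  have p_eq: "real m - \<alpha> / real ?n = p" using assms(1) by (simp add: p_def \<beta>_def field_simps)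
  obtain C where C: "0 < C" and weak: "\<And>(u :: nat \<Rightarrow> real ^ 'n \<Rightarrow> real) B X. finite B \<Longrightarrow>
    (\<forall>i<m. u i \<in> borel_measurable lebesgue \<and> (\<forall>y. 0 \<le> u i y) \<and> 0 \<le> X i \<and>
      (\<integral>\<^sup>+y. ennreal ((Phi ?n ^^ m) (u i y)) \<partial>lebesgue) = ennreal (X i)) \<Longrightarrow>
    (\<forall>(a, b)\<in>B. (\<forall>k. a $ k < b $ k) \<and>
      ennreal ((measure lebesgue (box a b) powr (1 - \<beta>)) ^ m) <
        (\<Prod>i<m. \<integral>\<^sup>+y\<in>box a b. ennreal (u i y) \<partial>lebesgue)) \<Longrightarrow>
    measure lebesgue (\<Union>(a, b)\<in>B. box a b) powr p \<le>
      C * (1 + (\<beta> * log_plus (\<Prod>i<m. X i)) ^ (?n - 1)) ^ (m * m) * (\<Prod>i<m. X i)"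
    using that unfolding p_def by (rule fractional_box_family_weak_type[OF assms(1) \<beta>, where 'n = 'n])
  show ?thesis
    unfolding p_eq \<beta>_def[symmetric]
  proof (intro exI[of _ C] conjI C allI impI)
    fix f :: "nat \<Rightarrow> real ^ 'n \<Rightarrow> complex" and s :: real
    assume f: "\<forall>i<m. locally_integrable (f i)" and s: "0 < s"
    \<comment> \<open>The right-hand side depends on \<open>f i\<close> through this quotient only,
      and for it the threshold \<open>s ^ m\<close> becomes 1.\<close>
    define u where "u i = (\<lambda>y. cmod (f i y) / s)" for i
    define F where "F i = Phi_integral m s (f i)" for i
    have F: "F i = (\<integral>\<^sup>+y. ennreal ((Phi ?n ^^ m) (u i y)) \<partial>lebesgue)" for i
      by (simp add: F_def Phi_integral_def u_def)
    have u: "u i \<in> borel_measurable lebesgue" "0 \<le> u i y" if "i < m" for i y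
      using f that s locally_integrable_measurable[of "f i"] by (auto simp: u_def)
    define I where "I i R = (\<integral>\<^sup>+y\<in>R. ennreal (u i y) \<partial>lebesgue)" for i and R :: "(real ^ 'n) set"
    have I_le: "I i R \<le> F i" if "i < m" for i R
      unfolding I_def F using u(2)[OF that] Phi_iter_ge[where n = ?n and m = m]
      by (intro nn_integral_mono) (auto simp: indicator_def intro: ennreal_leI)
    have cmod_int: "(\<integral>\<^sup>+y\<in>box a b. ennreal (cmod (f i y)) \<partial>lebesgue) = ennreal s * I i (box a b)"
      if "i < m" for i a b
    proof -
      have box: "(indicator (box a b) :: real ^ 'n \<Rightarrow> ennreal) \<in> borel_measurable lebesgue"
        by (rule borel_measurable_indicator) simp
      have "ennreal s * I i (box a b) = (\<integral>\<^sup>+y. ennreal s * (ennreal (u i y) * indicator (box a b) y) \<partial>lebesgue)"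
        unfolding I_def using u(1)[OF that] box
        by (intro nn_integral_cmult[symmetric] borel_measurable_times_ennreal measurable_compose[OF _ measurable_ennreal])
      also have "\<dots> = (\<integral>\<^sup>+y\<in>box a b. ennreal (cmod (f i y)) \<partial>lebesgue)"
        using s by (intro nn_integral_cong) (simp add: u_def mult.assoc[symmetric] ennreal_mult'[symmetric])
      finally show ?thesis by simp
    qed
    define P where "P R \<longleftrightarrow> ennreal (s ^ m) < (\<Prod>i<m. (\<integral>\<^sup>+y\<in>R. ennreal (cmod (f i y)) \<partial>lebesgue) /
        ennreal (measure lebesgue R powr (1 - \<beta>)))" for R :: "(real ^ 'n) set"
    define U where "U = {x. frac_strong_maximal m \<alpha> f x > ennreal (s ^ m)}"
    have U: "U = \<Union>{R \<in> rectangles. P R}"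
      unfolding U_def P_def frac_strong_maximal_def less_SUP_iff \<beta>_def by blast
    have I_pos: "0 < I i (box a b)" if "P (box a b)" "i < m" for i a b
    proof (rule ccontr)
      assume "\<not> 0 < I i (box a b)"
      then have "(\<integral>\<^sup>+y\<in>box a b. ennreal (cmod (f i y)) \<partial>lebesgue) = 0"
        using cmod_int[OF that(2)] by simp
      then have eq: "(\<Prod>i<m. (\<integral>\<^sup>+y\<in>box a b. ennreal (cmod (f i y)) \<partial>lebesgue) /
        ennreal (measure lebesgue (box a b) powr (1 - \<beta>))) = 0"
        using that(2) by (intro prod_zero) auto
      show False using that(1) unfolding P_def eq by simp
    qed
    let ?w = "1 + (ennreal \<beta> * elog_plus (\<Prod>j<m. F j)) ^ (?n - 1)"
    have w: "1 \<le> ?w ^ m" by (intro one_le_power) simp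
    \<comment> \<open>Since 0 * \<infinity> = 0, a vanishing integral makes the right-hand side 0
      even if another one is infinite. This case thus takes precedence and requires an empty level
      set, which holds because the integral of \<open>u i\<close> over any rectangle is at most
      \<open>F i\<close>.\<close>
    consider "\<exists>i<m. F i = 0" | "\<forall>i<m. F i \<noteq> 0" "\<exists>i<m. F i = \<infinity>" | "\<forall>i<m. F i \<noteq> \<infinity>"
      by blast
    then have "epowr (emeasure lebesgue U) p \<le> ennreal C * (\<Prod>i<m. ?w ^ m * F i)"
    proof cases
      case 1
      then obtain i where i: "i < m" "F i = 0" by blast
      have "\<not> P R" if R: "R \<in> rectangles" for R
      proof
        assume "P R"
        moreover obtain a b where "R = box a b" using R by (auto simp: rectangles_def)
        ultimately show False using I_pos[of a b i] I_le[OF i(1), of R] i by simp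
      qed
      then have "U = {}" unfolding U by blast
      then show ?thesis using p by (simp add: epowr_def)
    next
      case 2
      have "(\<Prod>i<m. ?w ^ m * F i) = \<infinity>"
      proof -
        have w0: "?w ^ m \<noteq> 0" using w by (metis not_one_le_zero)
        obtain i where i: "i < m" "F i = \<infinity>" using 2 by blast
        have "?w ^ m * F i = \<infinity>" unfolding i(2) using w0 by (simp only: ennreal_mult_eq_top_iff infinity_ennreal_def) simp
        moreover have "\<forall>j<m. ?w ^ m * F j \<noteq> 0" using 2 w0 by (simp only: mult_eq_0_iff) blast
        ultimately show ?thesis using i(1) unfolding infinity_ennreal_def by (subst ennreal_prod_eq_top) blast
      qed
      then show ?thesis using C by (simp add: ennreal_mult_top)
    next
      case 3
      define X where "X i = enn2real (F i)" for i
      have X: "F i = ennreal (X i)" "0 \<le> X i" if "i < m" for i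
        using 3 that by (simp_all add: X_def less_top)
      define Z where "Z = (\<Prod>i<m. X i)"
      have Z: "0 \<le> Z" unfolding Z_def using X by (intro prod_nonneg) auto
      have prodF: "(\<Prod>j<m. F j) = ennreal Z"
        unfolding Z_def using X by (subst prod_ennreal[symmetric]) auto
      define l where "l = 1 + (\<beta> * log_plus Z) ^ (?n - 1)"
      have l: "1 \<le> l" using \<beta> by (simp add: l_def)
      have w_eq: "1 + (ennreal \<beta> * elog_plus (ennreal Z)) ^ (?n - 1) = ennreal l"
        unfolding l_def using \<beta> Z
        by (simp add: elog_plus_def ennreal_mult'[symmetric] ennreal_power ennreal_plus[symmetric] flip: ennreal_1 del: ennreal_plus)
      define r where "r = C * l ^ (m * m) * Z"
      have r: "0 \<le> r" using C l Z by (simp add: r_def)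
      have rhs: "ennreal C * (\<Prod>i<m. ?w ^ m * F i) = ennreal r"
      proof -
        have "(\<Prod>i<m. ?w ^ m * F i) = ennreal l ^ (m * m) * ennreal Z"
          by (simp only: prod.distrib prodF w_eq prod_constant card_lessThan power_mult)
        then show ?thesis using C l Z by (simp add: r_def ennreal_mult' ennreal_power mult.assoc)
      qed
      \<comment> \<open>The exhaustion bounds measures and not their powers, so the estimate for
        finite families passes through the p-th root; p > 0 allows the return afterwards.\<close>
      have "emeasure lebesgue U \<le> ennreal (r powr (1 / p))"
        unfolding U
      proof (rule rectangle_family_exhaustion[where P = P])
        fix B assume B: "finite B"
          "\<And>a b. (a, b) \<in> B \<Longrightarrow> (\<forall>k. a $ k < b $ k) \<and> P (box a b)"
        let ?E = "\<Union>(a, b)\<in>B. box a b"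
        have "measure lebesgue ?E powr p \<le> r"
          unfolding r_def l_def Z_def
        proof (rule weak[OF B(1), where u = u and X = X])
          show "\<forall>i<m. u i \<in> borel_measurable lebesgue \<and> (\<forall>y. 0 \<le> u i y) \<and> 0 \<le> X i \<and>
              (\<integral>\<^sup>+y. ennreal ((Phi ?n ^^ m) (u i y)) \<partial>lebesgue) = ennreal (X i)"
            using u X F by auto
          show "\<forall>(a, b)\<in>B. (\<forall>k. a $ k < b $ k) \<and>
            ennreal ((measure lebesgue (box a b) powr (1 - \<beta>)) ^ m) <
              (\<Prod>i<m. \<integral>\<^sup>+y\<in>box a b. ennreal (u i y) \<partial>lebesgue)"
          proof (clarify, intro conjI)
            fix a b assume ab: "(a, b) \<in> B"
            show "\<forall>k. a $ k < b $ k" using B(2) ab by blast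
            then have vol: "0 < measure lebesgue (box a b)"
              by (subst measure_lebesgue_box_cart) (auto intro: less_imp_le prod_pos)
            define q where "q = measure lebesgue (box a b) powr (1 - \<beta>)"
            have q: "0 < q" using vol unfolding q_def by (simp only: powr_gt_zero)
            define J where "J i = enn2real (I i (box a b))" for i
            have J: "I i (box a b) = ennreal (J i)" "0 \<le> J i" if "i < m" for i
            proof -
              have "I i (box a b) < \<infinity>"
                using I_le[OF that, of "box a b"] 3 that by (metis infinity_ennreal_def less_top order_le_less_trans)
              then show "I i (box a b) = ennreal (J i)" "0 \<le> J i" by (simp_all add: J_def)
            qed
            have "ennreal (s ^ m) < (\<Prod>i<m. ennreal s * I i (box a b) / ennreal q)"
            proof -
              have "(\<Prod>i<m. (\<integral>\<^sup>+y\<in>box a b. ennreal (cmod (f i y)) \<partial>lebesgue) / ennreal q) =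
                  (\<Prod>i<m. ennreal s * I i (box a b) / ennreal q)"
                by (intro prod.cong) (auto simp: cmod_int)
              moreover have "P (box a b)" using B(2)[OF ab] by blast
              ultimately show ?thesis unfolding P_def q_def by simp
            qed
            also have "\<dots> = (\<Prod>i<m. ennreal (s * J i / q))"
              using J s q by (intro prod.cong refl) (simp add: ennreal_mult'[symmetric] divide_ennreal)
            also have "\<dots> = ennreal (\<Prod>i<m. s * J i / q)"
              using J s q by (intro prod_ennreal) auto
            also have "(\<Prod>i<m. s * J i / q) = s ^ m * ((\<Prod>i<m. J i) / q ^ m)"
              by (simp add: prod.distrib prod_dividef)
            finally have "s ^ m * 1 < s ^ m * ((\<Prod>i<m. J i) / q ^ m)"
              using s by (simp add: ennreal_less_iff)
            then have "1 < (\<Prod>i<m. J i) / q ^ m"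
              using s by (simp only: mult_less_cancel_left_pos zero_less_power)
            then have "q ^ m < (\<Prod>i<m. J i)" using q by (simp add: field_simps)
            then have "ennreal (q ^ m) < ennreal (\<Prod>i<m. J i)" using q by (simp add: ennreal_less_iff)
            also have "\<dots> = (\<Prod>i<m. I i (box a b))"
              using J by (subst prod_ennreal[symmetric]) auto
            finally show "ennreal ((measure lebesgue (box a b) powr (1 - \<beta>)) ^ m) <
              (\<Prod>i<m. \<integral>\<^sup>+y\<in>box a b. ennreal (u i y) \<partial>lebesgue)"
              by (simp add: q_def I_def)
          qed
        qed
        then have "(measure lebesgue ?E powr p) powr (1 / p) \<le> r powr (1 / p)"
          using p by (intro powr_mono2) auto
        then have "measure lebesgue ?E \<le> r powr (1 / p)"
          using p by (simp add: powr_powr)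
        moreover have "?E \<in> lmeasurable" using B(1) by (intro fmeasurable.finite_UN) auto
        ultimately show "emeasure lebesgue ?E \<le> ennreal (r powr (1 / p))"
          by (simp add: emeasure_eq_measure2 ennreal_leI)
      qed
      then obtain V where V: "emeasure lebesgue U = ennreal V" "0 \<le> V" "V \<le> r powr (1 / p)"
        by (cases "emeasure lebesgue U") (auto simp: top_unique)
      have "V powr p \<le> (r powr (1 / p)) powr p" using V p by (intro powr_mono2) auto
      also have "\<dots> = r" using p r by (simp add: powr_powr)
      finally have "V powr p \<le> r" .
      then show ?thesis unfolding rhs using V by (simp add: epowr_def ennreal_leI)
    qed
    then show "epowr (emeasure lebesgue {x. frac_strong_maximal m \<alpha> f x > ennreal (s ^ m)}) p \<le>
        ennreal C * (\<Prod>i<m. (1 + (ennreal \<beta> * elog_plus (\<Prod>j<m. Phi_integral m s (f j))) ^ (?n - 1)) ^ m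
          * Phi_integral m s (f i))"
      by (simp add: U_def F_def)
  qed
qed

end
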